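(* Let $N\in\mathbb{N}$, $m\in\mathbb{N}_0$, $\sigma\in(0,1]$, $s=m+\sigma$, $x\in B$, and $z\in\partial B$. Then $$E_{m,s}(x,z)=m_s\,D^s[G_s(x,\cdot)](z)=\frac1{\omega_N}\frac{\delta(x)^s}{|x-z|^N}=m_sM_s(x,z)$$ and, if $m\ge1$, $$E_{m-1,s}(x,z)=m_{s-1}\,D^{s-1}\big(-\Delta G_s(x,\cdot)\big)(z)=\frac1{4\omega_N}\frac{\delta(x)^s}{|x-z|^{N+2}}\big(N\delta(x)-(N-4)|x-z|^2\big),$$ $$E_{m,s}(x,z)=m_{s-1}\,D^{s-2}\big(\Delta G_s(x,\cdot)\big)(z).$$
   Context: $B=B_1(0)\subset\mathbb{R}^N$, $\delta(x)=(1-|x|^2)_+$, $\omega_N=|\partial B|=2\pi^{N/2}/\Gamma(N/2)$, $\Gamma$ is the Gamma function. In $\Delta G_s(x,\cdot)$ the Laplacian acts in the second variable. Constants: $k_{N,s}=\frac{2^{1-2s}}{\omega_N\Gamma(s)^2}$, $m_s=\frac{2s\,k_{N,1}}{k_{N,s}}=\frac{\Gamma(s)\Gamma(s+1)}{2^{1-2s}}$ for $s>0$. Green function: for $x\ne y$, $G_s(x,y)=k_{N,s}|x-y|^{2s-N}\int_0^{\rho(x,y)}\frac{t^{s-1}}{(t+1)^{N/2}}dt$ with $\rho(x,y)=\delta(x)\delta(y)|x-y|^{-2}$. Martin kernel: $M_s(x,z)=\frac{k_{N,s}}{s}\frac{(1-|x|^2)_+^s}{|x-z|^N}$ for $z\in\partial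 B$, $x\neq z$. Traces: any real number $>-1$ is uniquely of the form $k+\sigma-1$ with $k\in\mathbb{N}_0$, $\sigma\in(0,1]$, and for $z\in\partial B$ $$D^{k+\sigma-1}u(z)=\frac{(-1)^k}{k!}\lim_{x\to z}\frac{\partial^k}{\partial(|x|^2)^k}\big[(1-|x|^2)^{1-\sigma}u(x)\big],$$ where $\frac{\partial}{\partial(|x|^2)}=\frac1{2|x|}\frac{x}{|x|}\cdot\nabla$ and the limit is along $x\in B$ with $x/|x|=z$. In particular $D^{j}u(z)=\frac{(-1)^j}{j!}\lim_{x\to z}\frac{\partial^j}{\partial(|x|^2)^j}u(x)$ for $j\in\mathbb{N}_0$. Edenhofer kernels: for $s=m+\sigma$ ($m\in\mathbb{N}_0$, $\sigma\in(0,1]$), $k\in\{0,\ldots,m\}$, $\theta\in\partial B$, $E_{k,s}(x,\theta)=\frac1{\omega_N}(1-|x|^2)_+^s\,D^{m-k}\zeta_x(\theta)$, where $\zeta_x(y)=\frac{|y|^{N-2}}{|x-y|^N}$ (the integer-order trace $D^{m-k}$ acts in $y$). *)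

theory Defs
  imports "HOL-Analysis.Analysis"
begin

section \<open>Differential operators\<close>

definition dir_deriv :: "'a::real_normed_vector \<Rightarrow> ('a \<Rightarrow> real) \<Rightarrow> 'a \<Rightarrow> real" where
  "dir_deriv v u y = deriv (\<lambda>h. u (y + h *\<^sub>R v)) 0"

definition laplacian :: "(real ^ 'n \<Rightarrow> real) \<Rightarrow> real ^ 'n \<Rightarrow> real" where
  "laplacian u y = (\<Sum>i\<in>UNIV. dir_deriv (axis i 1) (dir_deriv (axis i 1) u) y)"

text \<open>The derivative with respect to \<open>|y|\<^sup>2\<close> along rays,
  \<open>1/(2|y|) (y/|y|) \<cdot> \<nabla>\<close>.\<close>

definition radial_deriv :: "(real ^ 'n \<Rightarrow> real) \<Rightarrow> real ^ 'n \<Rightarrow> real" where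
  "radial_deriv u y = 1 / (2 * norm y) * dir_deriv (y /\<^sub>R norm y) u y"

definition radially_differentiable :: "(real ^ 'n \<Rightarrow> real) \<Rightarrow> real ^ 'n \<Rightarrow> bool" where
  "radially_differentiable u y \<longleftrightarrow>
     (\<lambda>h. u (y + h *\<^sub>R (y /\<^sub>R norm y))) differentiable (at 0)"


section \<open>Boundary traces\<close>

definition ray_to :: "real ^ 'n \<Rightarrow> (real ^ 'n) filter" where
  "ray_to z = at z within {y \<in> ball 0 1. y /\<^sub>R norm y = z}"

text \<open>\<open>has_bdry_trace a u z L\<close>: the trace \<open>D\<^sup>a u(z)\<close> exists and equals \<open>L\<close>. Since \<^const>\<open>deriv\<close> is total,
  existence of the iterated radial derivatives near \<open>z\<close> is required explicitly. The
  decomposition \<open>a = k + \<sigma> - 1\<close> is unique.\<close>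

definition has_bdry_trace :: "real \<Rightarrow> (real ^ 'n \<Rightarrow> real) \<Rightarrow> real ^ 'n \<Rightarrow> real \<Rightarrow> bool" where
  "has_bdry_trace a u z L \<longleftrightarrow>
     (\<exists>(k::nat) \<sigma> l. 0 < \<sigma> \<and> \<sigma> \<le> 1 \<and> a = real k + \<sigma> - 1 \<and>
        (let w = (\<lambda>y. (1 - (norm y)\<^sup>2) powr (1 - \<sigma>) * u y) in
           (\<forall>j<k. eventually (radially_differentiable ((radial_deriv ^^ j) w)) (ray_to z)) \<and>
           ((radial_deriv ^^ k) w \<longlongrightarrow> l) (ray_to z)) \<and>
        L = (-1) ^ k / fact k * l)"

definition bdry_trace :: "real \<Rightarrow> (real ^ 'n \<Rightarrow> real) \<Rightarrow> real ^ 'n \<Rightarrow> real" where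
  "bdry_trace a u z = (THE L. has_bdry_trace a u z L)"

lemma ray_to_neq_bot:
  fixes z :: "real ^ 'n"
  assumes "norm z = 1"
  shows "ray_to z \<noteq> bot"
proof -
  have "z islimpt {y \<in> ball 0 1. y /\<^sub>R norm y = z}"
    unfolding islimpt_approachable
  proof (intro allI impI)
    fix e :: real assume "e > 0"
    define c where "c = 1 - min (e/2) (1/2)"
    have c: "0 < c" "c < 1" "1 - c < e"
      using \<open>e > 0\<close> by (auto simp: c_def min_def)
    have "dist (c *\<^sub>R z) z = norm ((c - 1) *\<^sub>R z)"
      by (simp add: dist_norm algebra_simps)
    also have "\<dots> < e" using c assms by simp
    finally have "dist (c *\<^sub>R z) z < e" .
    moreover have "c *\<^sub>R z \<noteq> z" using c assms by (metis less_irrefl mult.right_neutral norm_scaleR abs_of_pos)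
    ultimately show "\<exists>y\<in>{y \<in> ball 0 1. y /\<^sub>R norm y = z}. y \<noteq> z \<and> dist y z < e"
      using c assms by (intro bexI[of _ "c *\<^sub>R z"]) auto
  qed
  then show ?thesis
    by (simp add: ray_to_def trivial_limit_within)
qed

lemma bdry_trace_eqI:
  fixes z :: "real ^ 'n"
  assumes z: "norm z = 1" and L: "has_bdry_trace a u z L"
  shows "bdry_trace a u z = L"
  unfolding bdry_trace_def
proof (rule the_equality, rule L)
  fix L' assume L': "has_bdry_trace a u z L'"
  from L obtain k \<sigma> l where 1: "0 < \<sigma>" "\<sigma> \<le> 1" "a = real k + \<sigma> - 1"
    "((radial_deriv ^^ k) (\<lambda>y. (1 - (norm y)\<^sup>2) powr (1 - \<sigma>) * u y) \<longlongrightarrow> l) (ray_to z)"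
    "L = (-1) ^ k / fact k * l"
    unfolding has_bdry_trace_def Let_def by blast
  from L' obtain k' \<sigma>' l' where 2: "0 < \<sigma>'" "\<sigma>' \<le> 1" "a = real k' + \<sigma>' - 1"
    "((radial_deriv ^^ k') (\<lambda>y. (1 - (norm y)\<^sup>2) powr (1 - \<sigma>') * u y) \<longlongrightarrow> l') (ray_to z)"
    "L' = (-1) ^ k' / fact k' * l'"
    unfolding has_bdry_trace_def Let_def by blast
  have k: "k = k'" using 1(1-3) 2(1-3) by linarith
  then have "\<sigma> = \<sigma>'" using 1(3) 2(3) by simp
  with k 1(4) 2(4) have "l = l'"
    using tendsto_unique[OF ray_to_neq_bot[OF z]] by blast
  with k show "L' = L" using 1(5) 2(5) by simp
qed


section \<open>Constants and kernels\<close>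

definition omega :: "nat \<Rightarrow> real" where
  "omega N = 2 * pi powr (real N / 2) / Gamma (real N / 2)"

definition k_const :: "nat \<Rightarrow> real \<Rightarrow> real" where
  "k_const N s = 2 powr (1 - 2 * s) / (omega N * (Gamma s)\<^sup>2)"

definition m_const :: "nat \<Rightarrow> real \<Rightarrow> real" where
  "m_const N s = 2 * s * k_const N 1 / k_const N s"

lemma m_const_eq:
  assumes "N > 0" "s > 0"
  shows "m_const N s = Gamma s * Gamma (s + 1) / 2 powr (1 - 2 * s)"
proof -
  have "omega N > 0" using assms by (simp add: omega_def Gamma_real_pos)
  moreover have "Gamma s > 0" using assms by (simp add: Gamma_real_pos)
  moreover have "Gamma (s + 1) = s * Gamma s"
    using assms nonpos_Ints_nonpos[of s] Gamma_plus1[of s] by fastforce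
  moreover have "2 powr (-1) = (1/2::real)" by (simp add: powr_minus)
  ultimately show ?thesis
    by (simp add: m_const_def k_const_def field_simps power2_eq_square)
qed

definition delta :: "real ^ 'n \<Rightarrow> real" where
  "delta x = max 0 (1 - (norm x)\<^sup>2)"

definition rho :: "real ^ 'n \<Rightarrow> real ^ 'n \<Rightarrow> real" where
  "rho x y = delta x * delta y / (norm (x - y))\<^sup>2"

text \<open>Only meaningful for \<open>x \<noteq> y\<close>.\<close>

definition green :: "real \<Rightarrow> real ^ 'n \<Rightarrow> real ^ 'n \<Rightarrow> real" where
  "green s x y =
     k_const CARD('n) s * norm (x - y) powr (2 * s - real CARD('n)) *
     integral {0..rho x y} (\<lambda>t. t powr (s - 1) / (t + 1) powr (real CARD('n) / 2))"

definition martin :: "real \<Rightarrow> real ^ 'n \<Rightarrow> real ^ 'n \<Rightarrow> real" where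
  "martin s x z = k_const CARD('n) s / s * (delta x powr s / norm (x - z) ^ CARD('n))"

definition zeta :: "real ^ 'n \<Rightarrow> real ^ 'n \<Rightarrow> real" where
  "zeta x y = norm y powi (int CARD('n) - 2) / norm (x - y) ^ CARD('n)"

text \<open>For \<open>s > 0\<close>, \<open>\<lceil>s\<rceil> - 1\<close> is the \<open>m\<close> in \<open>s = m + \<sigma>\<close> with \<open>\<sigma> \<in> (0,1]\<close>;
  only meaningful for \<open>k \<le> m\<close>.\<close>

definition edenhofer :: "nat \<Rightarrow> real \<Rightarrow> real ^ 'n \<Rightarrow> real ^ 'n \<Rightarrow> real" where
  "edenhofer k s x \<theta> =
     1 / omega CARD('n) * delta x powr s *
     bdry_trace (real_of_int (\<lceil>s\<rceil> - 1) - real k) (zeta x) \<theta>"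

end

theory Submission
  imports Defs "HOL-Complex_Analysis.Laurent_Convergence"
begin

text \<open>Fix \<open>x\<close> and approach \<open>z\<close> along the ray \<open>y = sqrt (1 - d) z\<close>, so that \<open>d = 1 - |y|\<^sup>2\<close> tends to \<open>0\<close>.
  Differentiation with respect to \<open>|y|\<^sup>2\<close> is minus differentiation in \<open>d\<close>. Hence, if
  \<open>u = d powr \<alpha> * F d\<close> on the ray, with \<open>\<alpha> > -1\<close> and \<open>F\<close> analytic at \<open>0\<close>, the trace of order \<open>\<alpha> + i\<close> is
  the \<open>i\<close>-th Taylor coefficient of \<open>F\<close> at \<open>0\<close> (\<open>has_bdry_trace_expansion\<close>). The theorem therefore
  amounts to finding the first one or two Taylor coefficients of three functions:
  \<open>zeta x\<close> with \<open>\<alpha> = 0\<close>, \<open>green s x\<close> with \<open>\<alpha> = s\<close>, and the Laplacian of \<open>green s x\<close> with \<open>\<alpha> = s - 2\<close>.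

  Put \<open>N = CARD('n)\<close>, \<open>c = N/2\<close>, \<open>a = |x - y|\<^sup>2\<close> and \<open>e = 1 - |x|\<^sup>2\<close>; then \<open>rho x y = e d / a\<close>.
  The integral in the Green function is \<open>rho powr s\<close> times a power series in \<open>rho\<close> with value
  \<open>1/s\<close> at \<open>0\<close> (\<open>inc_beta_analytic\<close>). So the expansion of \<open>green s x\<close> starts with
  \<open>k_const N s / s * e powr s * a powr (- c)\<close>, the Martin kernel.

  For the Laplacian it is decisive that, as a function \<open>g\<close> of \<open>a\<close> and \<open>d\<close> and without the constant
  \<open>k_const\<close>, the Green function is homogeneous of degree \<open>s - c\<close> and has the elementary derivative
  \<open>e powr s * d powr (s - 1) * (a + e d) powr (- c)\<close> in \<open>d\<close>. All second order terms then collapse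
  (\<open>laplacian_green\<close>) to
  \<open>4 (s - 1) ((s - c) g / a + e powr s * d powr (s - 2) * (a + e d) powr (- c) * (1 - d - d\<^sup>2 / a))\<close>.
  Since \<open>g\<close> has order \<open>d powr s\<close>, the terms of order \<open>s - 2\<close> and \<open>s - 1\<close> come only from
  \<open>(a + e d) powr (- c) * (1 - d)\<close>, and the two traces of the Laplacian are elementary. Up to
  constants they agree with the traces of \<open>zeta x\<close> because \<open>2 (x \<bullet> z) = 1 + |x|\<^sup>2 - |x - z|\<^sup>2\<close>, and the constants agree because
  \<open>k_const N s / k_const N (s - 1) = 1 / (4 (s - 1)\<^sup>2)\<close>.\<close>

section \<open>Traces as Taylor coefficients in the variable 1 - |y|^2\<close>

text \<open>On the ray through \<open>z\<close> the operator \<open>radial_deriv\<close> differentiates with respect to \<open>|y|\<^sup>2\<close>,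
  hence it is minus the derivative in \<open>d = 1 - |y|\<^sup>2\<close>. Writing the function as the real part of a
  holomorphic function of \<open>d\<close> gives all higher derivatives, and their limits at \<open>d = 0\<close>, for free.\<close>

lemma radial_deriv_sqrt:
  fixes z :: "real ^ 'n"
  assumes z: "norm z = 1" and r: "r \<le> 1" and G: "G holomorphic_on ball 0 r"
    and v: "\<And>d. 0 < d \<Longrightarrow> d < r \<Longrightarrow> v (sqrt (1 - d) *\<^sub>R z) = Re (G (of_real d))"
    and d: "0 < d" "d < r"
  shows "radially_differentiable v (sqrt (1 - d) *\<^sub>R z)"
    and "radial_deriv v (sqrt (1 - d) *\<^sub>R z) = - Re (deriv G (of_real d))"
proof -
  define c where "c = sqrt (1 - d)"
  have c: "c > 0" "1 - c\<^sup>2 = d" using d r by (auto simp: c_def)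
  have unit: "(c *\<^sub>R z) /\<^sub>R norm (c *\<^sub>R z) = z" using c z by simp
  have G': "(G has_field_derivative deriv G (of_real d)) (at (of_real (1 - (c + 0)\<^sup>2)))"
    using holomorphic_derivI[OF G open_ball, of "of_real d"] d c by simp
  have "((\<lambda>h. G (of_real (1 - (c + h)\<^sup>2))) has_vector_derivative (- 2 * c) *\<^sub>R deriv G (of_real d)) (at 0)"
  proof -
    have 1: "((\<lambda>h. of_real (1 - (c + h)\<^sup>2) :: complex) has_vector_derivative of_real (- 2 * c)) (at 0)"
      by (rule has_vector_derivative_of_real) (auto intro!: derivative_eq_intros)
    from field_vector_diff_chain_at[OF this, of G] G'
    show ?thesis by (simp add: o_def scaleR_conv_of_real mult.commute)
  qed
  from bounded_linear.has_vector_derivative[OF bounded_linear_Re this]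
  have Re': "((\<lambda>h. Re (G (of_real (1 - (c + h)\<^sup>2)))) has_real_derivative - 2 * c * Re (deriv G (of_real d))) (at 0)"
    by (simp add: has_real_derivative_iff_has_vector_derivative)
  have "((\<lambda>h. 1 - (c + h)\<^sup>2) \<longlongrightarrow> 1 - (c + 0)\<^sup>2) (nhds 0)"
    by (intro tendsto_intros filterlim_ident)
  then have "eventually (\<lambda>h. 1 - (c + h)\<^sup>2 \<in> {0<..<r}) (nhds 0)"
    using c d by (intro topological_tendstoD) auto
  moreover have "((\<lambda>h. c + h) \<longlongrightarrow> c + 0) (nhds 0)" by (intro tendsto_intros filterlim_ident)
  then have "eventually (\<lambda>h. c + h \<in> {0<..}) (nhds 0)"
    using c by (intro topological_tendstoD) auto
  ultimately have "eventually (\<lambda>h. v (c *\<^sub>R z + h *\<^sub>R z) = Re (G (of_real (1 - (c + h)\<^sup>2)))) (nhds 0)"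
  proof eventually_elim
    case (elim h)
    \<comment> \<open>A step of length \<open>h\<close> along the ray replaces \<open>d\<close> by \<open>1 - (c + h)\<^sup>2\<close>.\<close>
    have "c *\<^sub>R z + h *\<^sub>R z = sqrt (1 - (1 - (c + h)\<^sup>2)) *\<^sub>R z"
      using elim by (simp add: scaleR_left_distrib)
    then show ?case using v[of "1 - (c + h)\<^sup>2"] elim by simp
  qed
  then have D: "((\<lambda>h. v (c *\<^sub>R z + h *\<^sub>R z)) has_real_derivative - 2 * c * Re (deriv G (of_real d))) (at 0)"
    by (rule DERIV_cong_ev[OF refl _ refl, THEN iffD2, OF _ Re'])
  show "radially_differentiable v (sqrt (1 - d) *\<^sub>R z)"
    using D unfolding radially_differentiable_def c_def[symmetric] unit
    by (meson real_differentiable_def)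
  show "radial_deriv v (sqrt (1 - d) *\<^sub>R z) = - Re (deriv G (of_real d))"
    using DERIV_imp_deriv[OF D] c z
    unfolding radial_deriv_def dir_deriv_def c_def[symmetric] unit by simp
qed

lemma higher_radial_deriv_sqrt:
  fixes z :: "real ^ 'n"
  assumes z: "norm z = 1" and r: "r \<le> 1" and G: "G holomorphic_on ball 0 r"
    and v: "\<And>d. 0 < d \<Longrightarrow> d < r \<Longrightarrow> v (sqrt (1 - d) *\<^sub>R z) = Re (G (of_real d))"
    and d: "0 < d" "d < r"
  shows "(radial_deriv ^^ j) v (sqrt (1 - d) *\<^sub>R z) = (-1) ^ j * Re ((deriv ^^ j) G (of_real d))"
    and "radially_differentiable ((radial_deriv ^^ j) v) (sqrt (1 - d) *\<^sub>R z)"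
proof -
  have hol: "(\<lambda>w. (-1) ^ j * (deriv ^^ j) G w) holomorphic_on ball 0 r" for j
    by (intro holomorphic_intros holomorphic_higher_deriv G) auto
  have Re_sign: "Re ((-1) ^ j * w) = (-1) ^ j * Re w" for j w
    by (cases "even j") auto
  have *: "(radial_deriv ^^ j) v (sqrt (1 - d) *\<^sub>R z) = Re ((-1) ^ j * (deriv ^^ j) G (of_real d))"
    if "0 < d" "d < r" for d j
    using that
  proof (induction j arbitrary: d)
    case 0
    then show ?case using v by simp
  next
    case (Suc j)
    have fd: "(deriv ^^ j) G field_differentiable at (of_real d)"
      by (rule holomorphic_on_imp_differentiable_at[OF holomorphic_higher_deriv[OF G]])
         (use Suc.prems in auto)
    from radial_deriv_sqrt(2)[OF z r hol Suc.IH Suc.prems]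
    show ?case using fd by (simp add: deriv_cmult)
  qed
  show "(radial_deriv ^^ j) v (sqrt (1 - d) *\<^sub>R z) = (-1) ^ j * Re ((deriv ^^ j) G (of_real d))"
    using *[OF d, of j] Re_sign by simp
  show "radially_differentiable ((radial_deriv ^^ j) v) (sqrt (1 - d) *\<^sub>R z)"
    by (rule radial_deriv_sqrt(1)[OF z r hol * d])
qed

text \<open>A point \<open>y\<close> of the open ray through \<open>z\<close> is \<open>sqrt (1 - d) z\<close> with \<open>d = 1 - |y|\<^sup>2\<close>, and \<open>y \<rightarrow> z\<close> forces
  \<open>d \<rightarrow> 0\<close>. The centre of the ball is not on the ray, since \<open>0 /\<^sub>R 0 = 0\<close> is not a unit vector.\<close>

lemma eventually_ray_toI:
  fixes z :: "real ^ 'n"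
  assumes "eventually (\<lambda>d. P (sqrt (1 - d) *\<^sub>R z)) (at_right 0)" and z: "norm z = 1"
  shows "eventually P (ray_to z)"
proof -
  from assms obtain e where e: "e > 0" "\<And>d. 0 < d \<Longrightarrow> d < e \<Longrightarrow> P (sqrt (1 - d) *\<^sub>R z)"
    by (auto simp: eventually_at_right_field)
  have "((\<lambda>y. 1 - (norm y)\<^sup>2) \<longlongrightarrow> 1 - (norm z)\<^sup>2) (ray_to z)"
    unfolding ray_to_def by (intro tendsto_intros)
  then have "eventually (\<lambda>y. 1 - (norm y)\<^sup>2 < e) (ray_to z)"
    using e z by (intro order_tendstoD) auto
  moreover have "eventually (\<lambda>y. y \<in> ball 0 1 \<and> y /\<^sub>R norm y = z) (ray_to z)"
    unfolding ray_to_def by (simp add: eventually_at_filter)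
  ultimately show ?thesis
  proof eventually_elim
    case (elim y)
    then have y: "norm y < 1" "y /\<^sub>R norm y = z" by auto
    then have "y \<noteq> 0" using z by auto
    then have "sqrt (1 - (1 - (norm y)\<^sup>2)) *\<^sub>R z = y" using y by auto
    moreover have "0 < 1 - (norm y)\<^sup>2" using y by (simp add: power2_eq_square abs_square_less_1[unfolded power2_eq_square])
    ultimately show ?case using e(2)[of "1 - (norm y)\<^sup>2"] elim by simp
  qed
qed

lemma higher_deriv_power_times_0:
  fixes F :: "complex \<Rightarrow> complex"
  assumes "F analytic_on {0}"
  shows "(deriv ^^ (j + i)) (\<lambda>w. w ^ j * F w) 0 / fact (j + i) = (deriv ^^ i) F 0 / fact i"
proof -
  have F: "F has_fps_expansion fps_expansion F 0"
    using assms by (rule analytic_at_imp_has_fps_expansion_0)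
  have "(\<lambda>w. w ^ j * F w) has_fps_expansion fps_X ^ j * fps_expansion F 0"
    by (intro fps_expansion_intros F)
  from fps_nth_fps_expansion[OF this, of "j + i"] fps_nth_fps_expansion[OF F, of i]
  show ?thesis by (simp add: fps_X_power_mult_nth)
qed

text \<open>The tool by which every trace below is computed. The order \<open>\<alpha> + i\<close> splits as
  \<open>(j + i) + \<sigma> - 1\<close> with \<open>\<alpha> + 1 = j + \<sigma>\<close>. After multiplication with \<open>d powr (1 - \<sigma>)\<close> the function
  \<open>u\<close> becomes \<open>d\<^sup>j F(d)\<close>, and the normalisation \<open>(-1)\<^sup>k/k!\<close> of the trace turns the derivative of
  order \<open>k = j + i\<close> into a Taylor coefficient, which is the \<open>i\<close>-th one of \<open>F\<close>.\<close>

lemma has_bdry_trace_expansion: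
  fixes z :: "real ^ 'n"
  assumes z: "norm z = 1" and F: "F analytic_on {0}" and \<alpha>: "\<alpha> > -1"
    and u: "eventually (\<lambda>d. u (sqrt (1 - d) *\<^sub>R z) = d powr \<alpha> * Re (F (of_real d))) (at_right 0)"
  shows "has_bdry_trace (\<alpha> + real i) u z (Re ((deriv ^^ i) F 0) / fact i)"
proof -
  \<comment> \<open>The rounding puts \<open>\<sigma>\<close> into \<open>(0, 1]\<close>: an integer \<open>\<alpha>\<close> gives \<open>\<sigma> = 1\<close>.\<close>
  define j where "j = nat (\<lceil>\<alpha> + 1\<rceil> - 1)"
  define \<sigma> where "\<sigma> = \<alpha> + 1 - real j"
  have j: "real j = real_of_int \<lceil>\<alpha> + 1\<rceil> - 1" using \<alpha> by (simp add: j_def)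
  have \<sigma>: "0 < \<sigma>" "\<sigma> \<le> 1" unfolding \<sigma>_def j by linarith+
  define w where "w = (\<lambda>y::real^'n. (1 - (norm y)\<^sup>2) powr (1 - \<sigma>) * u y)"
  define G where "G = (\<lambda>w. w ^ j * F w)"
  have "G analytic_on {0}" unfolding G_def by (intro analytic_intros F)
  then obtain r0 where r0: "r0 > 0" "G holomorphic_on ball 0 r0"
    by (auto simp: analytic_on_def)
  from u obtain e where e: "e > 0"
    "\<And>d. 0 < d \<Longrightarrow> d < e \<Longrightarrow> u (sqrt (1 - d) *\<^sub>R z) = d powr \<alpha> * Re (F (of_real d))"
    by (auto simp: eventually_at_right_field)
  define r where "r = min 1 (min r0 e)"
  have r: "0 < r" "r \<le> 1" "r \<le> r0" "r \<le> e" using r0 e by (auto simp: r_def)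
  have G: "G holomorphic_on ball 0 r"
    using r0 r by (auto intro: holomorphic_on_subset)
  have wG: "w (sqrt (1 - d) *\<^sub>R z) = Re (G (of_real d))" if "0 < d" "d < r" for d
  proof -
    have "w (sqrt (1 - d) *\<^sub>R z) = d powr (1 - \<sigma>) * (d powr \<alpha> * Re (F (of_real d)))"
      using that r z e by (simp add: w_def)
    also have "\<dots> = d powr real j * Re (F (of_real d))"
      by (simp add: \<sigma>_def powr_add [symmetric] mult.assoc [symmetric])
    also have "\<dots> = Re (G (of_real d))"
      using that by (simp add: G_def powr_realpow flip: of_real_power)
    finally show ?thesis .
  qed
  note higher = higher_radial_deriv_sqrt[OF z r(2) G wG]
  have near: "eventually (\<lambda>d. 0 < d \<and> d < r) (at_right (0::real))"
    using r by (auto simp: eventually_at_right_field)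
  have diff: "eventually (radially_differentiable ((radial_deriv ^^ l) w)) (ray_to z)" for l
    by (rule eventually_ray_toI[OF eventually_mono[OF near] z]) (use higher(2) in blast)
  define k where "k = j + i"
  have ev: "eventually (\<lambda>y. (radial_deriv ^^ k) w y
              = (-1) ^ k * Re ((deriv ^^ k) G (of_real (1 - (norm y)\<^sup>2)))) (ray_to z)"
    by (rule eventually_ray_toI[OF eventually_mono[OF near] z]) (use higher(1) z r in simp)
  have lim: "((\<lambda>y. (-1) ^ k * Re ((deriv ^^ k) G (of_real (1 - (norm y)\<^sup>2))))
               \<longlongrightarrow> (-1) ^ k * Re ((deriv ^^ k) G 0)) (ray_to z)"
  proof -
    have cont: "isCont ((deriv ^^ k) G) 0"
      using holomorphic_on_imp_continuous_on[OF holomorphic_higher_deriv[OF G open_ball]] r(1)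
      by (simp add: continuous_on_eq_continuous_at)
    have "((\<lambda>y. of_real (1 - (norm y)\<^sup>2) :: complex) \<longlongrightarrow> of_real (1 - (norm z)\<^sup>2)) (ray_to z)"
      unfolding ray_to_def by (intro tendsto_intros)
    then have "((\<lambda>y. of_real (1 - (norm y)\<^sup>2) :: complex) \<longlongrightarrow> 0) (ray_to z)"
      using z by simp
    from isCont_tendsto_compose[OF cont this] show ?thesis by (intro tendsto_intros)
  qed
  have "((radial_deriv ^^ k) w \<longlongrightarrow> (-1) ^ k * Re ((deriv ^^ k) G 0)) (ray_to z)"
    by (rule tendsto_cong[THEN iffD2, OF ev lim])
  moreover have "Re ((deriv ^^ i) F 0) / fact i = (-1) ^ k / fact k * ((-1) ^ k * Re ((deriv ^^ k) G 0))"
  proof -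
    have Re_fact: "Re (w / fact n) = Re w / fact n" for w n
      by (metis Re_divide_of_real of_real_fact)
    have "Re ((deriv ^^ i) F 0 / fact i) = Re ((deriv ^^ k) G 0 / fact k)"
      using higher_deriv_power_times_0[OF F, of j i] by (simp add: k_def G_def)
    then show ?thesis by (simp add: Re_fact flip: power_mult_distrib)
  qed
  moreover have "\<alpha> + real i = real k + \<sigma> - 1" by (simp add: k_def \<sigma>_def)
  ultimately show ?thesis
    unfolding has_bdry_trace_def Let_def using \<sigma> diff unfolding w_def by blast
qed

section \<open>The incomplete beta integral near 0\<close>

definition inc_beta :: "real \<Rightarrow> real \<Rightarrow> real \<Rightarrow> real" where
  "inc_beta s c r = integral {0..r} (\<lambda>t. t powr (s - 1) / (t + 1) powr c)"

text \<open>Expanding \<open>(1 + t) powr (-c)\<close> binomially and integrating \<open>t powr (s - 1 + j)\<close> term by term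
  gives \<open>r powr s\<close> times this series.\<close>

definition beta_fps :: "real \<Rightarrow> real \<Rightarrow> real fps" where
  "beta_fps s c = Abs_fps (\<lambda>j. ((- c) gchoose j) / (s + real j))"

lemma fps_conv_radius_beta_fps:
  assumes "s > 0"
  shows "fps_conv_radius (beta_fps s c) \<ge> 1"
  unfolding fps_conv_radius_def
proof (rule conv_radius_geI_ex')
  fix r :: real assume r: "0 < r" "ereal r < 1"
  then have r1: "ereal (norm r) < conv_radius (\<lambda>j. (- c) gchoose j :: real)"
    by (auto simp: conv_radius_gchoose)
  have sm: "summable (\<lambda>j. norm (((- c) gchoose j) * r ^ j) / s)"
    by (rule summable_divide[OF abs_summable_in_conv_radius[OF r1]])
  show "summable (\<lambda>j. fps_nth (beta_fps s c) j * of_real r ^ j)"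
  proof (rule summable_comparison_test'[OF sm, of 0])
    fix j :: nat
    have "norm (fps_nth (beta_fps s c) j * of_real r ^ j)
            = norm (((- c) gchoose j) * r ^ j) / (s + real j)"
      using assms by (simp add: beta_fps_def abs_mult)
    also have "\<dots> \<le> norm (((- c) gchoose j) * r ^ j) / s"
      using assms by (intro divide_left_mono) auto
    finally show "norm (fps_nth (beta_fps s c) j * of_real r ^ j)
            \<le> norm (((- c) gchoose j) * r ^ j) / s" .
  qed
qed

lemma less_fps_conv_radius_beta_fps:
  fixes r :: real
  assumes "s > 0" "\<bar>r\<bar> < 1"
  shows "ereal (norm r) < fps_conv_radius (beta_fps s c)"
proof -
  have "ereal (norm r) < 1" using assms by simp
  with fps_conv_radius_beta_fps[OF assms(1)] show ?thesis by (rule less_le_trans[rotated])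
qed

text \<open>In terms of the series, the derivative of \<open>r powr s * h r\<close> is \<open>r powr (s - 1) * (s * h r + r * h' r)\<close>;
  this differential equation identifies the bracket with \<open>(1 + r) powr (-c)\<close>, and the fundamental
  theorem of calculus does the rest.\<close>

lemma beta_fps_ode: "fps_const s * beta_fps s c + fps_X * fps_deriv (beta_fps s c) = fps_binomial (- c)"
  if "s > 0"
proof (rule fps_ext)
  fix j
  have "fps_nth (fps_const s * beta_fps s c + fps_X * fps_deriv (beta_fps s c)) j
          = (s + real j) * (((- c) gchoose j) / (s + real j))"
    by (cases j) (simp_all add: beta_fps_def ring_distribs add_divide_distrib del: of_nat_Suc)
  also have "\<dots> = fps_nth (fps_binomial (- c)) j"
    using that by simp
  finally show "fps_nth (fps_const s * beta_fps s c + fps_X * fps_deriv (beta_fps s c)) j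
          = fps_nth (fps_binomial (- c)) j" .
qed

lemma DERIV_powr_eval_beta_fps:
  assumes s: "s > 0" and r: "0 < r" "r < 1"
  shows "((\<lambda>r. r powr s * eval_fps (beta_fps s c) r) has_real_derivative
            r powr (s - 1) / (r + 1) powr c) (at r)"
proof -
  have R: "ereal (norm r) < fps_conv_radius (beta_fps s c)"
    using less_fps_conv_radius_beta_fps[OF s, of r c] r by simp
  have R': "ereal (norm r) < fps_conv_radius (fps_deriv (beta_fps s c))"
    using R fps_conv_radius_deriv[of "beta_fps s c"] by (rule less_le_trans)
  have "s * eval_fps (beta_fps s c) r + r * eval_fps (fps_deriv (beta_fps s c)) r
          = eval_fps (fps_const s * beta_fps s c + fps_X * fps_deriv (beta_fps s c)) r"
    using R R'
    by (subst eval_fps_add)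
       (auto simp: eval_fps_mult intro!: less_le_trans[OF _ fps_conv_radius_mult])
  also have "\<dots> = (1 + r) powr (- c)"
    unfolding beta_fps_ode[OF s]
    using gen_binomial_real[of r "- c"] r by (simp add: eval_fps_def sums_iff)
  finally have ode: "s * eval_fps (beta_fps s c) r + r * eval_fps (fps_deriv (beta_fps s c)) r
                       = 1 / (r + 1) powr c"
    by (simp add: powr_minus field_simps)
  have "((\<lambda>r. r powr s * eval_fps (beta_fps s c) r) has_real_derivative
          s * r powr (s - 1) * eval_fps (beta_fps s c) r
            + eval_fps (fps_deriv (beta_fps s c)) r * r powr s) (at r)"
    by (intro DERIV_mult has_real_derivative_powr r has_field_derivative_eval_fps R)
  also have "s * r powr (s - 1) * eval_fps (beta_fps s c) r
            + eval_fps (fps_deriv (beta_fps s c)) r * r powr s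
          = r powr (s - 1) * (s * eval_fps (beta_fps s c) r + r * eval_fps (fps_deriv (beta_fps s c)) r)"
  proof -
    have "r powr s = r powr (s - 1) * r" using r by (simp add: powr_mult_base powr_diff)
    then show ?thesis by (simp add: algebra_simps)
  qed
  finally show ?thesis by (simp add: ode)
qed

lemma inc_beta_eq_eval_fps:
  assumes s: "s > 0" and r: "0 \<le> r" "r < 1"
  shows "inc_beta s c r = r powr s * eval_fps (beta_fps s c) r"
proof -
  have "((\<lambda>t. t powr (s - 1) / (t + 1) powr c) has_integral
          r powr s * eval_fps (beta_fps s c) r - 0 powr s * eval_fps (beta_fps s c) 0) {0..r}"
  proof (rule fundamental_theorem_of_calculus_interior[OF r(1)])
    have R: "ereal (norm t) < fps_conv_radius (beta_fps s c)" if "t \<in> {0..r}" for t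
      using less_fps_conv_radius_beta_fps[OF s, of t c] r that by simp
    show "continuous_on {0..r} (\<lambda>r. r powr s * eval_fps (beta_fps s c) r)"
      using s R by (intro continuous_on_mult continuous_on_powr' continuous_on_eval_fps'
                       continuous_on_id continuous_on_const) auto
  next
    fix t assume "t \<in> {0<..<r}"
    then show "((\<lambda>r. r powr s * eval_fps (beta_fps s c) r) has_vector_derivative
                 t powr (s - 1) / (t + 1) powr c) (at t)"
      using DERIV_powr_eval_beta_fps[OF s, of t c] r
      by (simp add: has_real_derivative_iff_has_vector_derivative)
  qed
  then show ?thesis by (simp add: inc_beta_def integral_unique)
qed

lemma DERIV_inc_beta:
  assumes s: "s > 0" and r: "0 < r" "r < 1"
  shows "(inc_beta s c has_real_derivative r powr (s - 1) / (r + 1) powr c) (at r)"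
proof -
  have "eventually (\<lambda>t. t \<in> {0<..<1}) (nhds r)"
    using r by (intro eventually_nhds_in_open) auto
  then have "eventually (\<lambda>t. inc_beta s c t = t powr s * eval_fps (beta_fps s c) t) (nhds r)"
    by eventually_elim (simp add: inc_beta_eq_eval_fps[OF s])
  then show ?thesis
    by (rule DERIV_cong_ev[OF refl _ refl, THEN iffD2, OF _ DERIV_powr_eval_beta_fps[OF s r]])
qed

text \<open>The same coefficients define a complex power series. Thus \<open>inc_beta s c r / r powr s\<close> extends
  holomorphically across \<open>r = 0\<close>, which is where the boundary of the ball sits.\<close>

lemma inc_beta_analytic:
  assumes s: "s > 0"
  obtains H where "H analytic_on {0}" "H 0 = 1 / of_real s"
    "\<And>r. 0 < r \<Longrightarrow> r < 1 \<Longrightarrow> H (of_real r) = of_real (inc_beta s c r / r powr s)"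
proof
  define f :: "complex fps" where "f = Abs_fps (\<lambda>j. of_real (fps_nth (beta_fps s c) j))"
  have "fps_conv_radius f = fps_conv_radius (beta_fps s c)"
    unfolding fps_conv_radius_def f_def by (rule antisym) (simp_all add: conv_radius_def)
  then have "fps_conv_radius f > 0"
    using less_fps_conv_radius_beta_fps[OF s, of 0 c] by (simp add: zero_ereal_def)
  then show "eval_fps f analytic_on {0}"
    by (intro analytic_on_eval_fps) (auto simp: zero_ereal_def)
  show "eval_fps f 0 = 1 / of_real s"
    by (simp add: eval_fps_at_0 f_def beta_fps_def)
  show "eval_fps f (of_real r) = of_real (inc_beta s c r / r powr s)" if "0 < r" "r < 1" for r
  proof -
    have "ereal (norm r) < fps_conv_radius (beta_fps s c)"
      using less_fps_conv_radius_beta_fps[OF s, of r c] that by simp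
    then have "(\<lambda>n. fps_nth (beta_fps s c) n * r ^ n) sums eval_fps (beta_fps s c) r"
      by (rule sums_eval_fps)
    then have "(\<lambda>n. of_real (fps_nth (beta_fps s c) n * r ^ n) :: complex) sums of_real (eval_fps (beta_fps s c) r)"
      by (rule sums_of_real)
    then have "eval_fps f (of_real r) = of_real (eval_fps (beta_fps s c) r)"
      by (simp add: eval_fps_def f_def sums_iff)
    then show ?thesis using inc_beta_eq_eval_fps[OF s, of r c] that by simp
  qed
qed

section \<open>The Green function in terms of two squared distances\<close>

text \<open>Up to the constant \<open>k_const\<close>, this is the Green function inside the ball, with \<open>c = N/2\<close>, as a function of
  \<open>a = |x - y|\<^sup>2\<close> and \<open>d = 1 - |y|\<^sup>2\<close>, with \<open>e = 1 - |x|\<^sup>2\<close> as parameter.\<close>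

definition profile :: "real \<Rightarrow> real \<Rightarrow> real \<Rightarrow> real \<Rightarrow> real \<Rightarrow> real" where
  "profile s c e a d = a powr (s - c) * inc_beta s c (e * d / a)"

text \<open>The partial derivative of \<open>profile\<close> in \<open>d\<close>: the powers of the integrand at the upper limit
  \<open>e * d / a\<close> combine with \<open>a powr (s - c)\<close>, and the integral disappears.\<close>

definition profile_d :: "real \<Rightarrow> real \<Rightarrow> real \<Rightarrow> real \<Rightarrow> real \<Rightarrow> real" where
  "profile_d s c e a d = e powr s * d powr (s - 1) * (a + e * d) powr (- c)"

text \<open>The partial derivative of \<open>profile\<close> in \<open>a\<close>, obtained from Euler's relation: \<open>profile\<close> is
  homogeneous of degree \<open>s - c\<close> in \<open>(a, d)\<close>.\<close>

definition profile_a :: "real \<Rightarrow> real \<Rightarrow> real \<Rightarrow> real \<Rightarrow> real \<Rightarrow> real" where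
  "profile_a s c e a d = ((s - c) * profile s c e a d - d * profile_d s c e a d) / a"

lemma DERIV_profile:
  fixes a d :: "real \<Rightarrow> real"
  assumes s: "s > 0" and e: "e > 0" and pos: "a h > 0" "d h > 0" "e * d h < a h"
    and a: "(a has_real_derivative a') (at h)" and d: "(d has_real_derivative d') (at h)"
  shows "((\<lambda>h. profile s c e (a h) (d h)) has_real_derivative
            profile_a s c e (a h) (d h) * a' + profile_d s c e (a h) (d h) * d') (at h)"
proof -
  define A D r where "A = a h" and "D = d h" and "r = e * D / A"
  have AD: "A > 0" "D > 0" using pos by (auto simp: A_def D_def)
  have r: "0 < r" "r < 1" using pos e by (auto simp: r_def A_def D_def field_simps)
  have q: "((\<lambda>h. e * d h / a h) has_real_derivative (e * d' * A - e * D * a') / (A * A)) (at h)"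
    unfolding A_def D_def using pos by (auto intro!: derivative_eq_intros a d)
  have I: "((\<lambda>h. inc_beta s c (e * d h / a h)) has_real_derivative
          r powr (s - 1) / (r + 1) powr c * ((e * d' * A - e * D * a') / (A * A))) (at h)"
    by (rule DERIV_chain2[OF _ q])
       (use DERIV_inc_beta[OF s r, of c] in \<open>simp add: r_def A_def D_def\<close>)
  have P: "((\<lambda>h. a h powr (s - c)) has_real_derivative (s - c) * A powr (s - c - 1) * a') (at h)"
    unfolding A_def by (rule DERIV_chain2[OF has_real_derivative_powr a]) (use pos in auto)
  have key: "A powr (s - c) * (r powr (s - 1) / (r + 1) powr c) * (e / A) = profile_d s c e A D"
  proof -
    have r1: "(r + 1) powr c = (A + e * D) powr c / A powr c"
    proof -
      have "r + 1 = (A + e * D) / A" using AD by (simp add: r_def field_simps)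
      then show ?thesis using AD e by (simp add: powr_divide)
    qed
    have rs: "r powr (s - 1) = e powr s * D powr (s - 1) * A / (e * A powr s)"
      using AD e by (simp add: r_def powr_divide powr_mult powr_diff)
    show ?thesis
      unfolding profile_d_def r1 rs using AD e by (simp add: powr_minus powr_diff field_simps)
  qed
  have deriv_eq: "(s - c) * A powr (s - c - 1) * a' * inc_beta s c r
         + r powr (s - 1) / (r + 1) powr c * ((e * d' * A - e * D * a') / (A * A)) * A powr (s - c)
       = profile_a s c e A D * a' + profile_d s c e A D * d'"
  proof -
    have "r powr (s - 1) / (r + 1) powr c * ((e * d' * A - e * D * a') / (A * A)) * A powr (s - c)
        = (A powr (s - c) * (r powr (s - 1) / (r + 1) powr c) * (e / A)) * (d' - D * a' / A)"
      using AD by (simp add: field_simps)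
    also have "\<dots> = profile_d s c e A D * (d' - D * a' / A)" by (simp only: key)
    finally have 1: "r powr (s - 1) / (r + 1) powr c * ((e * d' * A - e * D * a') / (A * A)) * A powr (s - c)
        = profile_d s c e A D * (d' - D * a' / A)" .
    have 2: "A powr (s - c - 1) = A powr (s - c) / A" using AD by (simp add: powr_diff)
    show ?thesis
      unfolding 1 2 profile_a_def profile_def r_def[symmetric] using AD by (simp add: field_simps)
  qed
  show ?thesis
    unfolding profile_def
    by (rule DERIV_cong[OF DERIV_mult[OF P I]])
       (use deriv_eq in \<open>simp add: A_def D_def r_def\<close>)
qed

lemma DERIV_profile_d:
  fixes a d :: "real \<Rightarrow> real"
  assumes e: "e > 0" and pos: "a h > 0" "d h > 0"
    and a: "(a has_real_derivative a') (at h)" and d: "(d has_real_derivative d') (at h)"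
  shows "((\<lambda>h. profile_d s c e (a h) (d h)) has_real_derivative
            profile_d s c e (a h) (d h) *
              ((s - 1) / d h * d' - c / (a h + e * d h) * (a' + e * d'))) (at h)"
proof -
  have pos': "a h + e * d h > 0" using e pos by (simp add: add_pos_pos)
  have D: "((\<lambda>h. d h powr (s - 1)) has_real_derivative (s - 1) * d h powr (s - 1 - 1) * d') (at h)"
    by (rule DERIV_chain2[OF has_real_derivative_powr d]) (use pos in auto)
  have "((\<lambda>h. a h + e * d h) has_real_derivative a' + e * d') (at h)"
    by (auto intro!: derivative_eq_intros a d)
  from DERIV_chain2[OF has_real_derivative_powr[OF pos', of "- c"] this]
  have B: "((\<lambda>h. (a h + e * d h) powr (- c)) has_real_derivative
              - c * (a h + e * d h) powr (- c - 1) * (a' + e * d')) (at h)" by simp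
  have 1: "d h powr (s - 1 - 1) = d h powr (s - 1) / d h"
    using powr_diff[of "d h" "s - 1" 1] pos by simp
  have 2: "(a h + e * d h) powr (- c - 1) = (a h + e * d h) powr (- c) / (a h + e * d h)"
    using pos' by (simp add: powr_diff)
  show ?thesis
    unfolding profile_d_def
    by (rule DERIV_cong[OF DERIV_mult[OF DERIV_cmult[OF D] B]])
       (simp only: 1 2, simp add: algebra_simps)
qed

text \<open>The coefficient of \<open>d'\<close> is also the derivative of \<open>profile_d\<close> in \<open>a\<close>: the mixed second
  derivatives of \<open>profile\<close> agree.\<close>

lemma DERIV_profile_a:
  fixes a d :: "real \<Rightarrow> real"
  assumes s: "s > 0" and e: "e > 0" and pos: "a h > 0" "d h > 0" "e * d h < a h"
    and a: "(a has_real_derivative a') (at h)" and d: "(d has_real_derivative d') (at h)"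
  shows "((\<lambda>h. profile_a s c e (a h) (d h)) has_real_derivative
            ((s - c - 1) * profile_a s c e (a h) (d h)
               + c * d h / (a h + e * d h) * profile_d s c e (a h) (d h)) / a h * a'
            - c / (a h + e * d h) * profile_d s c e (a h) (d h) * d') (at h)"
proof -
  define A D P Pa Pd where "A = a h" and "D = d h" and "P = profile s c e A D"
    and "Pa = profile_a s c e A D" and "Pd = profile_d s c e A D"
  note defs = A_def D_def P_def Pa_def Pd_def
  have AD: "A > 0" "D > 0" "A + e * D > 0" using pos e by (auto simp: A_def D_def add_pos_pos)
  have P': "((\<lambda>h. profile s c e (a h) (d h)) has_real_derivative Pa * a' + Pd * d') (at h)"
    unfolding defs by (rule DERIV_profile[OF assms])
  have Pd': "((\<lambda>h. profile_d s c e (a h) (d h)) has_real_derivative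
      Pd * ((s - 1) / D * d' - c / (A + e * D) * (a' + e * d'))) (at h)"
    unfolding defs by (rule DERIV_profile_d[OF e pos(1,2) a d])
  have "((\<lambda>h. ((s - c) * profile s c e (a h) (d h) - d h * profile_d s c e (a h) (d h)) / a h)
         has_real_derivative
          (((s - c) * (Pa * a' + Pd * d') - (d' * Pd + Pd * ((s - 1) / D * d' - c / (A + e * D) * (a' + e * d')) * D)) * A
            - ((s - c) * P - D * Pd) * a') / (A * A)) (at h)"
    using DERIV_divide[OF DERIV_diff[OF DERIV_cmult[OF P'] DERIV_mult[OF d Pd']] a, of "s - c"] pos
    by (simp add: defs)
  moreover have "(s - c) * P - D * Pd = Pa * A"
    using AD by (simp add: Pa_def P_def Pd_def profile_a_def)
  moreover have "(((s - c) * (Pa * a' + Pd * d') - (d' * Pd + Pd * ((s - 1) / D * d' - c / (A + e * D) * (a' + e * d')) * D)) * A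
            - (Pa * A) * a') / (A * A)
      = ((s - c - 1) * Pa + c * D / (A + e * D) * Pd) / A * a' - c / (A + e * D) * Pd * d'"
  proof -
    \<comment> \<open>Eliminating \<open>e\<close> in favour of \<open>B\<close> makes the identity a rational one in \<open>A\<close>, \<open>D\<close>, \<open>B\<close>.\<close>
    define B where "B = A + e * D"
    have eD: "e * D = B - A" by (simp add: B_def)
    have B: "B > 0" using AD by (simp add: B_def)
    have "Pd * ((s - 1) / D * d' - c / B * (a' + e * d')) * D
          = Pd * ((s - 1) * d' - c / B * (D * a' + (e * D) * d'))"
      using AD(2) by (simp add: field_simps)
    then show ?thesis
      unfolding B_def[symmetric] eD using AD B by (simp add: field_simps)
  qed
  ultimately show ?thesis by (simp add: defs profile_a_def[of _ _ _ "a _"])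
qed

section \<open>The Laplacian of the Green function\<close>

lemma sum_inner_axis:
  fixes p q :: "real ^ 'n"
  shows "(\<Sum>i\<in>UNIV. (p \<bullet> axis i 1) * (q \<bullet> axis i 1)) = p \<bullet> q"
  unfolding inner_axis by (simp add: inner_vec_def)

lemma DERIV_inner_line:
  fixes p v :: "'a :: real_inner"
  shows "((\<lambda>h. (p + h *\<^sub>R v) \<bullet> q) has_real_derivative v \<bullet> q) (at h)"
  and "((\<lambda>h. (p + h *\<^sub>R v) \<bullet> (p + h *\<^sub>R v)) has_real_derivative 2 * ((p + h *\<^sub>R v) \<bullet> v)) (at h)"
proof -
  show "((\<lambda>h. (p + h *\<^sub>R v) \<bullet> q) has_real_derivative v \<bullet> q) (at h)"
    unfolding inner_add_left inner_scaleR_left by (auto intro!: derivative_eq_intros)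
  have "(\<lambda>h. (p + h *\<^sub>R v) \<bullet> (p + h *\<^sub>R v)) = (\<lambda>h. p \<bullet> p + 2 * h * (p \<bullet> v) + h\<^sup>2 * (v \<bullet> v))"
    by (auto simp: inner_add_left inner_add_right inner_commute power2_eq_square algebra_simps)
  then show "((\<lambda>h. (p + h *\<^sub>R v) \<bullet> (p + h *\<^sub>R v)) has_real_derivative 2 * ((p + h *\<^sub>R v) \<bullet> v)) (at h)"
    by (auto intro!: derivative_eq_intros simp: inner_add_left)
qed

text \<open>For \<open>|x| < 1\<close> the second condition says that \<open>y \<noteq> x\<close> and \<open>rho x y < 1\<close>, so that the power series for the
  integral applies. The set is open and contains all points of the open ball close to the sphere.\<close>

definition near_bdry :: "real ^ 'n \<Rightarrow> (real ^ 'n) set" where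
  "near_bdry x = {y. 0 < 1 - y \<bullet> y \<and> (1 - x \<bullet> x) * (1 - y \<bullet> y) < (y - x) \<bullet> (y - x)}"

lemma open_near_bdry: "open (near_bdry x)"
  unfolding near_bdry_def by (intro open_Collect_conj open_Collect_less continuous_intros)

lemma eventually_line_in:
  fixes y v :: "'a :: real_normed_vector"
  assumes "open U" "y \<in> U"
  shows "eventually (\<lambda>h. y + h *\<^sub>R v \<in> U) (nhds 0)"
proof -
  have "((\<lambda>h. y + h *\<^sub>R v) \<longlongrightarrow> y + 0 *\<^sub>R v) (nhds 0)"
    by (intro tendsto_intros filterlim_ident)
  then show ?thesis using assms by (intro topological_tendstoD) auto
qed

lemma green_eq_profile:
  fixes x y :: "real ^ 'n"
  assumes x: "x \<bullet> x < 1" and y: "y \<in> near_bdry x"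
  shows "green s x y = k_const CARD('n) s *
           profile s (real CARD('n) / 2) (1 - x \<bullet> x) ((y - x) \<bullet> (y - x)) (1 - y \<bullet> y)"
proof -
  have pos: "(y - x) \<bullet> (y - x) > 0" "1 - y \<bullet> y > 0"
    using y x unfolding near_bdry_def by (auto intro: le_less_trans[rotated])
  have n2: "(norm (x - y))\<^sup>2 = (y - x) \<bullet> (y - x)"
    by (metis norm_minus_commute power2_norm_eq_inner)
  have "norm (x - y) powr (2 * s - real CARD('n)) = ((y - x) \<bullet> (y - x)) powr (s - real CARD('n) / 2)"
  proof -
    have "norm (x - y) = ((y - x) \<bullet> (y - x)) powr (1 / 2)"
      using pos by (subst norm_minus_commute) (simp add: norm_eq_sqrt_inner powr_half_sqrt)
    then show ?thesis by (simp add: powr_powr right_diff_distrib')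
  qed
  moreover have "rho x y = (1 - x \<bullet> x) * (1 - y \<bullet> y) / ((y - x) \<bullet> (y - x))"
    using pos x unfolding rho_def delta_def n2 by (simp add: power2_norm_eq_inner)
  ultimately show ?thesis
    by (simp add: green_def profile_def inc_beta_def)
qed

lemma dir_deriv_green:
  fixes x y :: "real ^ 'n" and s :: real
  defines "c \<equiv> real CARD('n) / 2" and "e \<equiv> 1 - x \<bullet> x"
  assumes s: "s > 0" and x: "x \<bullet> x < 1" and y: "y \<in> near_bdry x"
  shows "dir_deriv v (green s x) y = 2 * k_const CARD('n) s *
           (profile_a s c e ((y - x) \<bullet> (y - x)) (1 - y \<bullet> y) * ((y - x) \<bullet> v)
            - profile_d s c e ((y - x) \<bullet> (y - x)) (1 - y \<bullet> y) * (y \<bullet> v))"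
proof -
  define A where "A = (\<lambda>h. (y - x + h *\<^sub>R v) \<bullet> (y - x + h *\<^sub>R v))"
  define D where "D = (\<lambda>h. 1 - (y + h *\<^sub>R v) \<bullet> (y + h *\<^sub>R v))"
  have e: "e > 0" using x by (simp add: e_def)
  have A0: "A 0 = (y - x) \<bullet> (y - x)" and D0: "D 0 = 1 - y \<bullet> y" by (simp_all add: A_def D_def)
  have pos: "A 0 > 0" "D 0 > 0" "e * D 0 < A 0"
    using y e unfolding near_bdry_def A0 D0 e_def by (auto intro: le_less_trans[rotated])
  have A': "(A has_real_derivative 2 * ((y - x) \<bullet> v)) (at 0)"
    using DERIV_inner_line(2)[of "y - x" v 0] by (simp add: A_def)
  have D': "(D has_real_derivative - 2 * (y \<bullet> v)) (at 0)"
    unfolding D_def by (auto intro!: derivative_eq_intros DERIV_inner_line(2))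
  have "eventually (\<lambda>h. green s x (y + h *\<^sub>R v) = k_const CARD('n) s * profile s c e (A h) (D h)) (nhds 0)"
    using eventually_line_in[OF open_near_bdry y, of v]
  proof eventually_elim
    case (elim h)
    have shift: "y + h *\<^sub>R v - x = y - x + h *\<^sub>R v" by simp
    show ?case using green_eq_profile[OF x elim, of s] unfolding shift by (simp add: A_def D_def c_def e_def)
  qed
  then have "((\<lambda>h. green s x (y + h *\<^sub>R v)) has_real_derivative
      k_const CARD('n) s * (profile_a s c e (A 0) (D 0) * (2 * ((y - x) \<bullet> v))
        + profile_d s c e (A 0) (D 0) * (- 2 * (y \<bullet> v)))) (at 0)"
    by (rule DERIV_cong_ev[OF refl _ refl, THEN iffD2,
          OF _ DERIV_cmult[OF DERIV_profile[OF s e pos A' D']]])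
  from DERIV_imp_deriv[OF this] show ?thesis
    by (simp add: dir_deriv_def A0 D0 algebra_simps)
qed

lemma dir_deriv_dir_deriv_green:
  fixes x y :: "real ^ 'n" and s :: real
  defines "c \<equiv> real CARD('n) / 2" and "e \<equiv> 1 - x \<bullet> x"
  defines "a \<equiv> (y - x) \<bullet> (y - x)" and "d \<equiv> 1 - y \<bullet> y"
  defines "Pa \<equiv> profile_a s c e a d" and "Pd \<equiv> profile_d s c e a d"
  assumes s: "s > 0" and x: "x \<bullet> x < 1" and y: "y \<in> near_bdry x"
  shows "dir_deriv v (dir_deriv v (green s x)) y = 2 * k_const CARD('n) s *
           (2 * ((s - c - 1) * Pa + c * d / (a + e * d) * Pd) / a * ((y - x) \<bullet> v * ((y - x) \<bullet> v))
            + 4 * c / (a + e * d) * Pd * ((y - x) \<bullet> v * (y \<bullet> v))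
            + 2 * Pd * ((s - 1) / d - c * e / (a + e * d)) * (y \<bullet> v * (y \<bullet> v))
            + (Pa - Pd) * (v \<bullet> v))"
proof -
  define A where "A = (\<lambda>h. (y - x + h *\<^sub>R v) \<bullet> (y - x + h *\<^sub>R v))"
  define D where "D = (\<lambda>h. 1 - (y + h *\<^sub>R v) \<bullet> (y + h *\<^sub>R v))"
  have e: "e > 0" using x by (simp add: e_def)
  have A0: "A 0 = a" and D0: "D 0 = d" by (simp_all add: A_def D_def a_def d_def)
  have pos: "A 0 > 0" "D 0 > 0" "e * D 0 < A 0"
    using y e unfolding near_bdry_def A0 D0 a_def d_def e_def by (auto intro: le_less_trans[rotated])
  have A': "(A has_real_derivative 2 * ((y - x) \<bullet> v)) (at 0)"
    using DERIV_inner_line(2)[of "y - x" v 0] by (simp add: A_def)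
  have D': "(D has_real_derivative - 2 * (y \<bullet> v)) (at 0)"
    unfolding D_def by (auto intro!: derivative_eq_intros DERIV_inner_line(2))
  have "eventually (\<lambda>h. dir_deriv v (green s x) (y + h *\<^sub>R v) = 2 * k_const CARD('n) s *
          (profile_a s c e (A h) (D h) * ((y - x + h *\<^sub>R v) \<bullet> v)
           - profile_d s c e (A h) (D h) * ((y + h *\<^sub>R v) \<bullet> v))) (nhds 0)"
    using eventually_line_in[OF open_near_bdry y, of v]
  proof eventually_elim
    case (elim h)
    have shift: "y + h *\<^sub>R v - x = y - x + h *\<^sub>R v" by simp
    show ?case using dir_deriv_green[OF s x elim, of v] unfolding shift by (simp add: A_def D_def c_def e_def)
  qed
  then have "((\<lambda>h. dir_deriv v (green s x) (y + h *\<^sub>R v)) has_real_derivative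
      2 * k_const CARD('n) s *
      ((((s - c - 1) * profile_a s c e (A 0) (D 0)
               + c * D 0 / (A 0 + e * D 0) * profile_d s c e (A 0) (D 0)) / A 0 * (2 * ((y - x) \<bullet> v))
            - c / (A 0 + e * D 0) * profile_d s c e (A 0) (D 0) * (- 2 * (y \<bullet> v))) * ((y - x + 0 *\<^sub>R v) \<bullet> v)
        + v \<bullet> v * profile_a s c e (A 0) (D 0)
        - (profile_d s c e (A 0) (D 0) *
              ((s - 1) / D 0 * (- 2 * (y \<bullet> v)) - c / (A 0 + e * D 0) * (2 * ((y - x) \<bullet> v) + e * (- 2 * (y \<bullet> v))))
              * ((y + 0 *\<^sub>R v) \<bullet> v)
            + v \<bullet> v * profile_d s c e (A 0) (D 0)))) (at 0)"
    by (rule DERIV_cong_ev[OF refl _ refl, THEN iffD2, OF _ DERIV_cmult[OF DERIV_diff[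
          OF DERIV_mult[OF DERIV_profile_a[OF s e pos A' D'] DERIV_inner_line(1)]
             DERIV_mult[OF DERIV_profile_d[OF e pos(1,2) A' D'] DERIV_inner_line(1)]]]])
  from DERIV_imp_deriv[OF this] show ?thesis
    unfolding A0 D0 Pa_def[symmetric] Pd_def[symmetric]
    by (simp add: dir_deriv_def[of v "dir_deriv v _"] algebra_simps add_divide_distrib diff_divide_distrib)
qed

text \<open>With \<open>g = profile\<close> the chain rule gives, up to the constant,
  \<open>\<Delta> = 4 a g\<^sub>a\<^sub>a - 4 (e - d + a) g\<^sub>a\<^sub>d + 4 (1 - d) g\<^sub>d\<^sub>d + 2 N (g\<^sub>a - g\<^sub>d)\<close>. By homogeneity \<open>g\<^sub>a\<^sub>a\<close> reduces to
  \<open>g\<^sub>a\<close> and \<open>g\<^sub>a\<^sub>d\<close>, and the remaining terms that contain \<open>b = a + e d\<close> in a denominator add up to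
  \<open>2 N g\<^sub>d\<close>, which cancels the last summand. What is left is \<open>4 (s - 1) (g\<^sub>a + (1 - d) g\<^sub>d / d)\<close>.\<close>

lemma laplacian_green:
  fixes x y :: "real ^ 'n" and s :: real
  defines "c \<equiv> real CARD('n) / 2" and "e \<equiv> 1 - x \<bullet> x"
  defines "a \<equiv> (y - x) \<bullet> (y - x)" and "d \<equiv> 1 - y \<bullet> y"
  assumes s: "s > 0" and x: "x \<bullet> x < 1" and y: "y \<in> near_bdry x"
  shows "laplacian (green s x) y = 4 * (s - 1) * k_const CARD('n) s *
           ((s - c) * profile s c e a d / a + profile_d s c e a d * (1 - d - d\<^sup>2 / a) / d)"
proof -
  define Pa Pd where "Pa = profile_a s c e a d" and "Pd = profile_d s c e a d"
  have pos: "a > 0" "d > 0" "e > 0"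
    using y x unfolding near_bdry_def a_def d_def e_def by (auto intro: le_less_trans[rotated])
  define b where "b = a + e * d"
  have b: "b > 0" using pos by (simp add: b_def add_pos_pos)
  \<comment> \<open>With \<open>y \<bullet> y = 1 - d\<close> this expresses the inner products of the two gradients by \<open>a\<close>, \<open>d\<close>, \<open>e\<close>.\<close>
  have yx: "(y - x) \<bullet> y = (e - d + a) / 2"
    by (simp add: a_def d_def e_def inner_diff_left inner_diff_right inner_commute)
  have yy: "y \<bullet> y = 1 - d" by (simp add: d_def)
  have n: "(\<Sum>i\<in>UNIV. axis i (1::real) \<bullet> (axis i 1 :: real ^ 'n)) = 2 * c"
    by (simp add: inner_axis c_def)
  have D2: "dir_deriv (axis i 1) (dir_deriv (axis i 1) (green s x)) y = 2 * k_const CARD('n) s *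
           (2 * ((s - c - 1) * Pa + c * d / b * Pd) / a * ((y - x) \<bullet> axis i 1 * ((y - x) \<bullet> axis i 1))
            + 4 * c / b * Pd * ((y - x) \<bullet> axis i 1 * (y \<bullet> axis i 1))
            + 2 * Pd * ((s - 1) / d - c * e / b) * (y \<bullet> axis i 1 * (y \<bullet> axis i 1))
            + (Pa - Pd) * (axis i 1 \<bullet> (axis i 1 :: real ^ 'n)))" for i
    unfolding Pa_def Pd_def b_def a_def c_def d_def e_def by (rule dir_deriv_dir_deriv_green[OF s x y])
  have "laplacian (green s x) y = 2 * k_const CARD('n) s *
           (2 * ((s - c - 1) * Pa + c * d / b * Pd) / a * a
            + 4 * c / b * Pd * ((e - d + a) / 2)
            + 2 * Pd * ((s - 1) / d - c * e / b) * (1 - d)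
            + (Pa - Pd) * (2 * c))"
    by (simp only: laplacian_def D2 sum_distrib_left[symmetric] sum.distrib sum_inner_axis n
          a_def[symmetric] yx yy)
  also have "\<dots> = 4 * (s - 1) * k_const CARD('n) s * (Pa + Pd * (1 - d) / d)"
  proof -
    have a_eq: "a = b - e * d" by (simp add: b_def)
    have "2 * ((s - c - 1) * Pa + c * d / b * Pd) / a * a
            + 4 * c / b * Pd * ((e - d + a) / 2)
            + 2 * Pd * ((s - 1) / d - c * e / b) * (1 - d)
            + (Pa - Pd) * (2 * c)
         = 2 * (s - c - 1) * Pa + 2 * c * Pa + 2 * (s - 1) * Pd * (1 - d) / d
            + 2 * c * Pd * ((d + (e - d + a) - e * (1 - d)) / b - 1)"
      using pos b by (simp add: field_simps)
    also have "d + (e - d + a) - e * (1 - d) = b" by (simp add: b_def algebra_simps)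
    also have "2 * (s - c - 1) * Pa + 2 * c * Pa + 2 * (s - 1) * Pd * (1 - d) / d
            + 2 * c * Pd * (b / b - 1) = 2 * (s - 1) * (Pa + Pd * (1 - d) / d)"
      using b by (simp add: field_simps)
    finally show ?thesis by simp
  qed
  also have "Pa + Pd * (1 - d) / d
      = (s - c) * profile s c e a d / a + Pd * (1 - d - d\<^sup>2 / a) / d"
    using pos by (simp add: Pa_def Pd_def profile_a_def field_simps power2_eq_square)
  finally show ?thesis by (simp add: Pd_def)
qed

section \<open>Expansions along the ray to a boundary point\<close>

text \<open>The holomorphic extension in \<open>w = 1 - |y|\<^sup>2\<close> of the squared distance \<open>|x - y|\<^sup>2\<close> along
  \<open>y = sqrt (1 - w) z\<close>.\<close>

definition ray_dist2 :: "real ^ 'n \<Rightarrow> real ^ 'n \<Rightarrow> complex \<Rightarrow> complex" where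
  "ray_dist2 x z w = 1 - w - of_real (2 * (x \<bullet> z)) * csqrt (1 - w) + of_real (x \<bullet> x)"

lemma ray_dist2_of_real:
  fixes x z :: "real ^ 'n"
  assumes "norm z = 1" "d \<le> 1"
  shows "ray_dist2 x z (of_real d) =
           of_real ((sqrt (1 - d) *\<^sub>R z - x) \<bullet> (sqrt (1 - d) *\<^sub>R z - x))"
proof -
  have "csqrt (1 - of_real d) = of_real (sqrt (1 - d))"
    using csqrt_of_real[of "1 - d"] assms by simp
  moreover have "z \<bullet> z = 1" using assms by (simp add: dot_square_norm)
  then have "(sqrt (1 - d) *\<^sub>R z - x) \<bullet> (sqrt (1 - d) *\<^sub>R z - x)
               = sqrt (1 - d) * sqrt (1 - d) - 2 * (x \<bullet> z) * sqrt (1 - d) + x \<bullet> x"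
    by (simp add: inner_diff_left inner_diff_right inner_commute)
  moreover have "sqrt (1 - d) * sqrt (1 - d) = 1 - d" using assms by simp
  ultimately show ?thesis
    by (simp only: ray_dist2_def of_real_mult of_real_diff of_real_add of_real_1)
qed

lemma ray_dist2_0:
  fixes x z :: "real ^ 'n"
  assumes "norm z = 1"
  shows "ray_dist2 x z 0 = of_real ((norm (x - z))\<^sup>2)"
  using ray_dist2_of_real[OF assms, of 0 x]
  by (simp add: norm_minus_commute[of x z] power2_norm_eq_inner[of "z - x"])

lemma DERIV_ray_dist2:
  "(ray_dist2 x z has_field_derivative of_real (x \<bullet> z - 1)) (at 0)"
  unfolding ray_dist2_def by (auto intro!: derivative_eq_intros)

lemma analytic_ray_dist2: "ray_dist2 x z analytic_on {0}"
  unfolding ray_dist2_def by (intro analytic_intros) auto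

lemma eventually_near_bdry:
  fixes x z :: "real ^ 'n"
  assumes z: "norm z = 1" and xz: "x \<noteq> z"
  shows "eventually (\<lambda>d. 0 < d \<and> d < 1 \<and> sqrt (1 - d) *\<^sub>R z \<in> near_bdry x) (at_right 0)"
proof -
  have zz: "z \<bullet> z = 1" using z by (simp add: dot_square_norm)
  have "((\<lambda>d. (sqrt (1 - d) *\<^sub>R z - x) \<bullet> (sqrt (1 - d) *\<^sub>R z - x) - (1 - x \<bullet> x) * d) \<longlongrightarrow>
          (sqrt (1 - 0) *\<^sub>R z - x) \<bullet> (sqrt (1 - 0) *\<^sub>R z - x) - (1 - x \<bullet> x) * 0) (at_right 0)"
    by (intro tendsto_intros)
  then have "eventually (\<lambda>d. 0 < (sqrt (1 - d) *\<^sub>R z - x) \<bullet> (sqrt (1 - d) *\<^sub>R z - x) - (1 - x \<bullet> x) * d) (at_right 0)"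
    by (rule order_tendstoD) (use xz in auto)
  moreover have "eventually (\<lambda>d. 0 < d \<and> d < (1::real)) (at_right 0)"
    by (auto simp: eventually_at_right_field intro: exI[of _ 1])
  ultimately show ?thesis
    by eventually_elim (auto simp: near_bdry_def zz)
qed

lemma inner_powr_half_dim:
  fixes p :: "real ^ 'n"
  assumes "p \<noteq> 0"
  shows "((p \<bullet> p) :: real) powr (- (real n / 2)) = 1 / norm p ^ n"
proof -
  have "p \<bullet> p = norm p powr 2" using assms by (simp add: power2_norm_eq_inner)
  then have "(p \<bullet> p) powr (- (real n / 2)) = norm p powr (- real n)"
    by (simp only: powr_powr) simp
  also have "\<dots> = 1 / norm p ^ n"
    using assms powr_minus_divide[of "norm p" "real n"] powr_realpow[of "norm p" n] by simp
  finally show ?thesis .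
qed

lemma powr_norm_sq:
  fixes x z :: "real ^ 'n"
  assumes "x \<noteq> z"
  shows "(norm (x - z))\<^sup>2 powr (- (real n / 2)) = 1 / norm (x - z) ^ n"
    and "(norm (x - z))\<^sup>2 powr (- (real n / 2) - 1) = 1 / norm (x - z) ^ (n + 2)"
proof -
  show *: "(norm (x - z))\<^sup>2 powr (- (real n / 2)) = 1 / norm (x - z) ^ n" for n
    using inner_powr_half_dim[of "x - z" n] assms by (simp add: power2_norm_eq_inner)
  have "- (real n / 2) - 1 = - (real (n + 2) / 2)" by (simp add: field_simps)
  then show "(norm (x - z))\<^sup>2 powr (- (real n / 2) - 1) = 1 / norm (x - z) ^ (n + 2)"
    by (simp only: *)
qed

lemma inner_eq_norm_sq:
  fixes x z :: "real ^ 'n"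
  assumes "norm z = 1"
  shows "2 * (x \<bullet> z) = 1 + x \<bullet> x - (norm (x - z))\<^sup>2"
proof -
  have "z \<bullet> z = 1" using assms by (simp add: dot_square_norm)
  then show ?thesis
    by (simp add: power2_norm_eq_inner inner_diff_left inner_diff_right inner_commute)
qed

lemma zeta_ray_expansion:
  fixes x z :: "real ^ 'n"
  assumes z: "norm z = 1" and xz: "x \<noteq> z"
  shows "eventually (\<lambda>d. zeta x (sqrt (1 - d) *\<^sub>R z) = d powr 0 *
            Re ((1 - of_real d) powr of_real (real CARD('n) / 2 - 1)
                * ray_dist2 x z (of_real d) powr of_real (- (real CARD('n) / 2)))) (at_right 0)"
  using eventually_near_bdry[OF z xz]
proof eventually_elim
  case (elim d)
  define y where "y = sqrt (1 - d) *\<^sub>R z"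
  have y: "norm y = sqrt (1 - d)" using elim z by (simp add: y_def)
  have yx: "y \<noteq> x"
  proof
    assume yx: "y = x"
    have "x \<bullet> x = 1 - d" using y elim by (simp add: yx dot_square_norm)
    then show False using elim unfolding near_bdry_def y_def[symmetric] by (simp add: yx)
  qed
  have "norm y powi (int CARD('n) - 2) = norm y powr (real CARD('n) - 2)"
    using elim by (simp add: y powr_real_of_int' [symmetric])
  also have "\<dots> = (1 - d) powr (real CARD('n) / 2 - 1)"
    using elim by (simp add: y powr_half_sqrt[symmetric] powr_powr diff_divide_distrib)
  finally have 1: "norm y powi (int CARD('n) - 2) = (1 - d) powr (real CARD('n) / 2 - 1)" .
  have 2: "1 / norm (x - y) ^ CARD('n) = ((y - x) \<bullet> (y - x)) powr (- (real CARD('n) / 2))"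
    using inner_powr_half_dim[of "y - x" "CARD('n)"] yx by (simp add: norm_minus_commute)
  have A: "ray_dist2 x z (of_real d) = of_real ((y - x) \<bullet> (y - x))"
    using ray_dist2_of_real[OF z, of d x] elim by (simp add: y_def)
  have 3: "(1 - of_real d) powr of_real (real CARD('n) / 2 - 1)
             = (of_real ((1 - d) powr (real CARD('n) / 2 - 1)) :: complex)"
    using powr_of_real[of "1 - d" "real CARD('n) / 2 - 1"] elim by simp
  have 4: "ray_dist2 x z (of_real d) powr of_real (- (real CARD('n) / 2))
             = of_real (1 / norm (x - y) ^ CARD('n))"
    unfolding A 2 by (rule powr_of_real) simp
  have "zeta x y = (1 - d) powr (real CARD('n) / 2 - 1) * (1 / norm (x - y) ^ CARD('n))"
    by (simp add: zeta_def 1)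
  also have "\<dots> = Re (of_real ((1 - d) powr (real CARD('n) / 2 - 1)) * of_real (1 / norm (x - y) ^ CARD('n)))"
    by (simp only: of_real_mult[symmetric] Re_complex_of_real)
  finally show ?case using elim unfolding 3 4 y_def by simp
qed

lemma profile_eq_powr_times:
  fixes H :: "complex \<Rightarrow> complex"
  assumes e: "e > 0" and a: "a > 0" and d: "d > 0" and r: "e * d < a"
    and H: "\<And>r. 0 < r \<Longrightarrow> r < 1 \<Longrightarrow> H (of_real r) = of_real (inc_beta s c r / r powr s)"
  shows "of_real (profile s c e a d) =
      of_real (d powr s) * (of_real (e powr s) * of_real a powr of_real (- c) * H (of_real e * of_real d / of_real a))"
proof -
  define q where "q = e * d / a"
  have q: "0 < q" "q < 1" using a d r e by (simp_all add: q_def)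
  have "profile s c e a d = a powr (s - c) * q powr s * (inc_beta s c q / q powr s)"
    using q by (simp add: profile_def q_def[symmetric])
  also have "a powr (s - c) * q powr s = d powr s * (e powr s * a powr (- c))"
    using a d e by (simp add: q_def powr_divide powr_mult powr_diff powr_minus field_simps)
  finally have prof: "profile s c e a d = d powr s * (e powr s * a powr (- c)) * (inc_beta s c q / q powr s)" .
  have "of_real (profile s c e a d) = of_real (d powr s) * (of_real (e powr s) * of_real (a powr (- c)) * H (of_real q))"
    by (simp only: prof H[OF q] of_real_mult mult.assoc)
  then show ?thesis using a powr_of_real[of a "- c"] by (simp add: q_def)
qed

text \<open>Up to constants, \<open>green_coeff\<close> and \<open>green_lap_coeff\<close> are what remains of the Green function and
  of its Laplacian on the ray after division by \<open>w powr s\<close> and \<open>w powr (s - 2)\<close>; here \<open>H\<close> is the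
  holomorphic extension of \<open>inc_beta s c r / r powr s\<close>. In \<open>green_lap_coeff\<close> the terms
  of order at least two are separated, because the traces below read off the orders \<open>0\<close> and \<open>1\<close>.\<close>

definition green_coeff :: "(complex \<Rightarrow> complex) \<Rightarrow> real ^ 'n \<Rightarrow> real ^ 'n \<Rightarrow> complex \<Rightarrow> complex" where
  "green_coeff H x z w = ray_dist2 x z w powr of_real (- (real CARD('n) / 2))
     * H (of_real (1 - x \<bullet> x) * w / ray_dist2 x z w)"

definition green_lap_coeff :: "real \<Rightarrow> (complex \<Rightarrow> complex) \<Rightarrow> real ^ 'n \<Rightarrow> real ^ 'n \<Rightarrow> complex \<Rightarrow> complex" where
  "green_lap_coeff s H x z w =
     (let b = (ray_dist2 x z w + of_real (1 - x \<bullet> x) * w) powr of_real (- (real CARD('n) / 2)) in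
      b * (1 - w) +
      w\<^sup>2 * ((of_real (s - real CARD('n) / 2) * green_coeff H x z w - b) / ray_dist2 x z w))"

lemma green_ray_expansion:
  fixes x z :: "real ^ 'n"
  assumes s: "s > 0" and x: "x \<bullet> x < 1" and z: "norm z = 1" and xz: "x \<noteq> z"
    and H: "\<And>r. 0 < r \<Longrightarrow> r < 1 \<Longrightarrow> H (of_real r) = of_real (inc_beta s (real CARD('n) / 2) r / r powr s)"
  shows "eventually (\<lambda>d. green s x (sqrt (1 - d) *\<^sub>R z) = d powr s *
            Re (of_real (k_const CARD('n) s * (1 - x \<bullet> x) powr s) * green_coeff H x z (of_real d))) (at_right 0)"
    and "eventually (\<lambda>d. laplacian (green s x) (sqrt (1 - d) *\<^sub>R z) = d powr (s - 2) *
            Re (of_real (4 * (s - 1) * k_const CARD('n) s * (1 - x \<bullet> x) powr s) * green_lap_coeff s H x z (of_real d))) (at_right 0)"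
proof -
  define c e where "c = real CARD('n) / 2" and "e = 1 - x \<bullet> x"
  have e: "e > 0" using x by (simp add: e_def)
  have pointwise: "green s x (sqrt (1 - d) *\<^sub>R z) = d powr s *
            Re (of_real (k_const CARD('n) s * (1 - x \<bullet> x) powr s) * green_coeff H x z (of_real d)) \<and>
      laplacian (green s x) (sqrt (1 - d) *\<^sub>R z) = d powr (s - 2) *
            Re (of_real (4 * (s - 1) * k_const CARD('n) s * (1 - x \<bullet> x) powr s) * green_lap_coeff s H x z (of_real d))"
    if d: "0 < d" "d < 1" and y: "sqrt (1 - d) *\<^sub>R z \<in> near_bdry x" for d
  proof -
    define y where "y = sqrt (1 - d) *\<^sub>R z"
    define a where "a = (y - x) \<bullet> (y - x)"
    have yy: "1 - y \<bullet> y = d" using z d by (simp add: y_def dot_square_norm)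
    have r: "e * d < a" using y unfolding near_bdry_def y_def[symmetric] by (simp add: a_def e_def yy)
    have a: "a > 0" using r e d by (meson less_trans mult_pos_pos)
    have A: "ray_dist2 x z (of_real d) = of_real a"
      using ray_dist2_of_real[OF z, of d x] d by (simp add: a_def y_def)
    define g where "g = profile s c e a d / (d powr s * e powr s)"
    have gc: "green_coeff H x z (of_real d) = of_real g"
      using profile_eq_powr_times[OF e a d(1) r H, folded c_def] d e
      by (simp add: g_def green_coeff_def A c_def[symmetric] e_def[symmetric] field_simps)
    have prof: "profile s c e a d = d powr s * (e powr s * g)"
      using d e by (simp add: g_def)
    have b: "(of_real a + of_real e * of_real d :: complex) powr of_real (- c) = of_real ((a + e * d) powr (- c))"
      using powr_of_real[of "a + e * d" "- c"] a e d by simp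
    have lc: "green_lap_coeff s H x z (of_real d) =
        of_real ((a + e * d) powr (- c) * (1 - d) + d\<^sup>2 * (((s - c) * g - (a + e * d) powr (- c)) / a))"
      unfolding green_lap_coeff_def Let_def A gc c_def[symmetric] e_def[symmetric] b by simp
    have 1: "green s x y = d powr s * (k_const CARD('n) s * e powr s * g)"
      using green_eq_profile[OF x, of y s] y
      by (simp add: y_def[symmetric] yy a_def[symmetric] c_def[symmetric] e_def[symmetric] prof)
    have d1: "d powr (s - 1) / d = d powr (s - 2)" and d2: "d powr s = d powr (s - 2) * d\<^sup>2"
      using d by (simp_all add: powr_diff power2_eq_square)
    have "laplacian (green s x) y = 4 * (s - 1) * k_const CARD('n) s *
           ((s - c) * profile s c e a d / a + profile_d s c e a d * (1 - d - d\<^sup>2 / a) / d)"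
      using laplacian_green[OF s x, of y] y
      by (simp add: y_def[symmetric] yy a_def[symmetric] c_def[symmetric] e_def[symmetric])
    also have "(s - c) * profile s c e a d / a + profile_d s c e a d * (1 - d - d\<^sup>2 / a) / d
        = e powr s * ((s - c) * d powr s * g / a + d powr (s - 1) / d * ((a + e * d) powr (- c) * (1 - d - d\<^sup>2 / a)))"
    proof -
      have "(s - c) * (d powr s * (e powr s * g)) / a + (e powr s * d powr (s - 1) * B) * W / d
          = e powr s * ((s - c) * d powr s * g / a + d powr (s - 1) / d * (B * W))" for B W
        by (simp add: algebra_simps)
      then show ?thesis unfolding prof profile_d_def .
    qed
    also have "\<dots> = d powr (s - 2) * (e powr s *
        ((a + e * d) powr (- c) * (1 - d) + d\<^sup>2 * (((s - c) * g - (a + e * d) powr (- c)) / a)))"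
      unfolding d1 d2 by (simp add: algebra_simps diff_divide_distrib add_divide_distrib)
    finally have 2: "laplacian (green s x) y = d powr (s - 2) * (4 * (s - 1) * k_const CARD('n) s * e powr s *
        ((a + e * d) powr (- c) * (1 - d) + d\<^sup>2 * (((s - c) * g - (a + e * d) powr (- c)) / a)))"
      by (simp add: algebra_simps)
    show ?thesis
      unfolding y_def[symmetric] gc lc e_def[symmetric] of_real_mult[symmetric] Re_complex_of_real
      using 1 2 by blast
  qed
  show "eventually (\<lambda>d. green s x (sqrt (1 - d) *\<^sub>R z) = d powr s *
            Re (of_real (k_const CARD('n) s * (1 - x \<bullet> x) powr s) * green_coeff H x z (of_real d))) (at_right 0)"
    and "eventually (\<lambda>d. laplacian (green s x) (sqrt (1 - d) *\<^sub>R z) = d powr (s - 2) *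
            Re (of_real (4 * (s - 1) * k_const CARD('n) s * (1 - x \<bullet> x) powr s) * green_lap_coeff s H x z (of_real d))) (at_right 0)"
    by (rule eventually_mono[OF eventually_near_bdry[OF z xz]]; use pointwise in blast)+
qed

section \<open>The boundary traces\<close>

lemma has_bdry_trace_zeta:
  fixes x z :: "real ^ 'n"
  assumes z: "norm z = 1" and xz: "x \<noteq> z"
  shows "has_bdry_trace 0 (zeta x) z (1 / norm (x - z) ^ CARD('n))"
    and "has_bdry_trace 1 (zeta x) z
           ((real CARD('n) * (1 - x \<bullet> x) - (real CARD('n) - 4) * (norm (x - z))\<^sup>2)
              / (4 * norm (x - z) ^ (CARD('n) + 2)))"
proof -
  define c D where "c = real CARD('n) / 2" and "D = (norm (x - z))\<^sup>2"
  have D: "D > 0" "ray_dist2 x z 0 = of_real D"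
    using ray_dist2_0[OF z, of x] xz by (simp_all add: D_def)
  define F where "F = (\<lambda>w. (1 - w) powr of_real (c - 1) * ray_dist2 x z w powr of_real (- c))"
  have F: "F analytic_on {0}"
    unfolding F_def by (intro analytic_intros analytic_ray_dist2) (use D in auto)
  have ray: "eventually (\<lambda>d. zeta x (sqrt (1 - d) *\<^sub>R z) = d powr 0 * Re (F (of_real d))) (at_right 0)"
    unfolding F_def c_def by (rule zeta_ray_expansion[OF z xz])
  have Dp: "(of_real D :: complex) powr of_real r = of_real (D powr r)" for r
    using D by (intro powr_of_real) simp
  note pw = powr_norm_sq[OF xz, of "CARD('n)", folded c_def D_def]
  have "F 0 = of_real (D powr (- c))"
    using D Dp[of "- c"] by (simp add: F_def)
  with has_bdry_trace_expansion[OF z F _ ray, of 0]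
  show "has_bdry_trace 0 (zeta x) z (1 / norm (x - z) ^ CARD('n))"
    by (simp add: pw)
  have "(F has_field_derivative
          (of_real (c - 1) * (1 - 0) powr (of_real (c - 1) - 1) * (- 1)) * of_real D powr of_real (- c)
          + (of_real (- c) * of_real D powr (of_real (- c) - 1) * of_real (x \<bullet> z - 1)) * (1 - 0) powr of_real (c - 1)) (at 0)"
    unfolding F_def D(2)[symmetric]
    by (rule DERIV_mult DERIV_chain2[OF has_field_derivative_powr _] DERIV_ray_dist2)+
       (use D DERIV_ray_dist2[of x z] in \<open>auto intro!: derivative_eq_intros\<close>)
  then have "deriv F 0 = of_real (- (c - 1) * D powr (- c) - c * D powr (- c - 1) * (x \<bullet> z - 1))"
    using Dp[of "- c"] Dp[of "- c - 1"] by (auto dest!: DERIV_imp_deriv)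
  then have "Re (deriv F 0) = - (c - 1) * D powr (- c) - c * D powr (- c - 1) * (x \<bullet> z - 1)"
    by simp
  also have "\<dots> = (real CARD('n) * (1 - x \<bullet> x) - (real CARD('n) - 4) * D) / 4 * D powr (- c - 1)"
  proof -
    have xz1: "x \<bullet> z - 1 = - (D + (1 - x \<bullet> x)) / 2"
      using inner_eq_norm_sq[OF z, of x] by (simp add: D_def)
    have Dc: "D powr (- c) = D powr (- c - 1) * D" using D by (simp add: powr_diff)
    show ?thesis unfolding xz1 Dc by (simp add: c_def field_simps)
  qed
  finally have "Re (deriv F 0) = (real CARD('n) * (1 - x \<bullet> x) - (real CARD('n) - 4) * D) / (4 * norm (x - z) ^ (CARD('n) + 2))"
    by (simp add: pw)
  with has_bdry_trace_expansion[OF z F _ ray, of 1]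
  show "has_bdry_trace 1 (zeta x) z
           ((real CARD('n) * (1 - x \<bullet> x) - (real CARD('n) - 4) * (norm (x - z))\<^sup>2)
              / (4 * norm (x - z) ^ (CARD('n) + 2)))"
    by (simp add: D_def)
qed

lemma analytic_green_coeff:
  fixes x z :: "real ^ 'n"
  assumes z: "norm z = 1" and xz: "x \<noteq> z" and H: "H analytic_on {0}"
  shows "green_coeff H x z analytic_on {0}"
proof -
  define D where "D = (norm (x - z))\<^sup>2"
  have "D > 0" "ray_dist2 x z 0 = of_real D"
    using ray_dist2_0[OF z, of x] xz by (simp_all add: D_def)
  then have D: "ray_dist2 x z 0 \<notin> \<real>\<^sub>\<le>\<^sub>0" "ray_dist2 x z 0 \<noteq> 0" by simp_all
  have q: "(\<lambda>w. of_real (1 - x \<bullet> x) * w / ray_dist2 x z w) analytic_on {0}"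
    by (intro analytic_intros analytic_ray_dist2) (use D in auto)
  have "(\<lambda>w. H (of_real (1 - x \<bullet> x) * w / ray_dist2 x z w)) analytic_on {0}"
    by (rule analytic_on_compose_gen[OF q H, unfolded o_def]) simp
  then show ?thesis
    unfolding green_coeff_def by (intro analytic_intros analytic_ray_dist2) (use D in auto)
qed

lemma has_bdry_trace_green:
  fixes x z :: "real ^ 'n"
  assumes s: "s > 0" and x: "x \<bullet> x < 1" and z: "norm z = 1" and xz: "x \<noteq> z"
  shows "has_bdry_trace s (green s x) z
           (k_const CARD('n) s / s * ((1 - x \<bullet> x) powr s / norm (x - z) ^ CARD('n)))"
proof -
  obtain H where H: "H analytic_on {0}" "H 0 = 1 / of_real s"
    "\<And>r. 0 < r \<Longrightarrow> r < 1 \<Longrightarrow> H (of_real r) = of_real (inc_beta s (real CARD('n) / 2) r / r powr s)"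
    using inc_beta_analytic[OF s] by blast
  define F where "F = (\<lambda>w. of_real (k_const CARD('n) s * (1 - x \<bullet> x) powr s) * green_coeff H x z w)"
  have F: "F analytic_on {0}"
    unfolding F_def by (intro analytic_intros analytic_green_coeff[OF z xz H(1)])
  have "F 0 = of_real (k_const CARD('n) s / s * ((1 - x \<bullet> x) powr s / norm (x - z) ^ CARD('n)))"
    using powr_of_real[of "(norm (x - z))\<^sup>2" "- (real CARD('n) / 2)"]
    by (simp add: F_def green_coeff_def ray_dist2_0[OF z] H(2) powr_norm_sq(1)[OF xz])
  moreover have "eventually (\<lambda>d. green s x (sqrt (1 - d) *\<^sub>R z) = d powr s * Re (F (of_real d))) (at_right 0)"
    unfolding F_def by (rule green_ray_expansion(1)[OF s x z xz H(3)])
  ultimately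
  show ?thesis using has_bdry_trace_expansion[OF z F, of s "green s x" 0] s by simp
qed

lemma DERIV_sq_times_0:
  fixes f :: "complex \<Rightarrow> complex"
  assumes "f analytic_on {0}"
  shows "((\<lambda>w. w\<^sup>2 * f w) has_field_derivative 0) (at 0)"
proof -
  obtain f' where "(f has_field_derivative f') (at 0)"
    using analytic_on_imp_differentiable_at[OF assms] by (auto simp: field_differentiable_def)
  then show ?thesis by (auto intro!: derivative_eq_intros)
qed

text \<open>The coefficients of order \<open>0\<close> and \<open>1\<close> of \<open>green_lap_coeff\<close> are those of
  \<open>(a + e w) powr (- c) * (1 - w)\<close>, where \<open>a\<close> is the squared distance on the ray.\<close>

lemma has_bdry_trace_laplacian_green:
  fixes x z :: "real ^ 'n"
  assumes s: "s > 1" and x: "x \<bullet> x < 1" and z: "norm z = 1" and xz: "x \<noteq> z"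
  shows "has_bdry_trace (s - 2) (laplacian (green s x)) z
           (4 * (s - 1) * k_const CARD('n) s * (1 - x \<bullet> x) powr s / norm (x - z) ^ CARD('n))"
    and "has_bdry_trace (s - 1) (\<lambda>y. - laplacian (green s x) y) z
           ((s - 1) * k_const CARD('n) s * (1 - x \<bullet> x) powr s / norm (x - z) ^ (CARD('n) + 2)
             * (real CARD('n) * (1 - x \<bullet> x) - (real CARD('n) - 4) * (norm (x - z))\<^sup>2))"
proof -
  define c D e where "c = real CARD('n) / 2" and "D = (norm (x - z))\<^sup>2" and "e = 1 - x \<bullet> x"
  have s0: "s > 0" using s by simp
  obtain H where H: "H analytic_on {0}"
    "\<And>r. 0 < r \<Longrightarrow> r < 1 \<Longrightarrow> H (of_real r) = of_real (inc_beta s (real CARD('n) / 2) r / r powr s)"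
    using inc_beta_analytic[OF s0] by metis
  have D: "D > 0" "ray_dist2 x z 0 = of_real D"
    using ray_dist2_0[OF z, of x] xz by (simp_all add: D_def)
  have Dp: "(of_real D :: complex) powr of_real r = of_real (D powr r)" for r
    using D by (intro powr_of_real) simp
  note pw = powr_norm_sq[OF xz, of "CARD('n)", folded c_def D_def]
  define K where "K = 4 * (s - 1) * k_const CARD('n) s * e powr s"
  define b where "b = (\<lambda>w. (ray_dist2 x z w + of_real e * w) powr of_real (- c))"
  define Q where "Q = (\<lambda>w. (of_real (s - c) * green_coeff H x z w - b w) / ray_dist2 x z w)"
  have L: "green_lap_coeff s H x z = (\<lambda>w. b w * (1 - w) + w\<^sup>2 * Q w)"
    by (auto simp: green_lap_coeff_def b_def Q_def Let_def c_def e_def)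
  have b: "b analytic_on {0}"
    unfolding b_def by (intro analytic_intros analytic_ray_dist2) (use D in auto)
  have Q: "Q analytic_on {0}"
    unfolding Q_def by (intro analytic_intros analytic_ray_dist2 analytic_green_coeff[OF z xz H(1)] b) (use D in auto)
  define F where "F = (\<lambda>w. of_real K * green_lap_coeff s H x z w)"
  have F: "F analytic_on {0}"
    unfolding F_def L by (intro analytic_intros b Q)
  have ray: "eventually (\<lambda>d. laplacian (green s x) (sqrt (1 - d) *\<^sub>R z) = d powr (s - 2) * Re (F (of_real d))) (at_right 0)"
    unfolding F_def K_def e_def by (rule green_ray_expansion(2)[OF s0 x z xz H(2)])
  have b0: "b 0 = of_real (D powr (- c))"
    using Dp[of "- c"] by (simp add: b_def D(2))
  have "F 0 = of_real (K * D powr (- c))" by (simp add: F_def L b0)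
  with has_bdry_trace_expansion[OF z F _ ray, of 0] s
  show "has_bdry_trace (s - 2) (laplacian (green s x)) z
           (4 * (s - 1) * k_const CARD('n) s * (1 - x \<bullet> x) powr s / norm (x - z) ^ CARD('n))"
    by (simp add: pw K_def e_def)
  have "(b has_field_derivative of_real (- c) * (of_real D + of_real e * 0) powr (of_real (- c) - 1)
           * (of_real (x \<bullet> z - 1) + of_real e * 1)) (at 0)"
    unfolding b_def D(2)[symmetric]
    by (rule DERIV_chain2[OF has_field_derivative_powr],
        use D in simp, intro DERIV_add DERIV_ray_dist2 DERIV_cmult DERIV_ident)
  then have b': "(b has_field_derivative of_real (- c * D powr (- c - 1) * (x \<bullet> z - 1 + e))) (at 0)"
    using Dp[of "- c - 1"] by simp
  have "((\<lambda>w. b w * (1 - w) + w\<^sup>2 * Q w) has_field_derivative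
           of_real (- c * D powr (- c - 1) * (x \<bullet> z - 1 + e) - D powr (- c))) (at 0)"
    by (rule derivative_eq_intros b' DERIV_sq_times_0[OF Q] refl)+ (simp add: b0)
  from DERIV_cmult[OF this, of "of_real K"]
  have "(F has_field_derivative of_real (K * (- c * D powr (- c - 1) * (x \<bullet> z - 1 + e) - D powr (- c)))) (at 0)"
    by (simp add: F_def L)
  then have "deriv (\<lambda>w. - F w) 0 = - of_real (K * (- c * D powr (- c - 1) * (x \<bullet> z - 1 + e) - D powr (- c)))"
    by (intro DERIV_imp_deriv DERIV_minus)
  then have "Re (deriv (\<lambda>w. - F w) 0) = - K * (- c * D powr (- c - 1) * (x \<bullet> z - 1 + e) - D powr (- c))"
    by simp
  also have "\<dots> = K / 4 * D powr (- c - 1) * (real CARD('n) * e - (real CARD('n) - 4) * D)"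
  proof -
    have xz1: "x \<bullet> z - 1 + e = (e - D) / 2"
      using inner_eq_norm_sq[OF z, of x] by (simp add: D_def e_def field_simps)
    have Dc: "D powr (- c) = D powr (- c - 1) * D" using D by (simp add: powr_diff)
    show ?thesis unfolding xz1 Dc by (simp add: c_def field_simps)
  qed
  finally have val: "Re (deriv (\<lambda>w. - F w) 0) = K / 4 / norm (x - z) ^ (CARD('n) + 2)
      * (real CARD('n) * e - (real CARD('n) - 4) * D)"
    by (simp add: pw)
  have "K / 4 = (s - 1) * k_const CARD('n) s * e powr s" by (simp add: K_def)
  note val = val[unfolded this]
  have "(\<lambda>w. - F w) analytic_on {0}" by (intro analytic_intros F)
  from has_bdry_trace_expansion[OF z this, of "s - 2" "\<lambda>y. - laplacian (green s x) y" 1] ray s val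
  show "has_bdry_trace (s - 1) (\<lambda>y. - laplacian (green s x) y) z
           ((s - 1) * k_const CARD('n) s * (1 - x \<bullet> x) powr s / norm (x - z) ^ (CARD('n) + 2)
             * (real CARD('n) * (1 - x \<bullet> x) - (real CARD('n) - 4) * (norm (x - z))\<^sup>2))"
    by (simp add: D_def e_def)
qed

section \<open>Constants and conclusion\<close>

lemma omega_pos: "N > 0 \<Longrightarrow> omega N > 0"
  by (simp add: omega_def Gamma_real_pos)

lemma k_const_pos: "N > 0 \<Longrightarrow> s > 0 \<Longrightarrow> k_const N s > 0"
  unfolding k_const_def
  by (intro divide_pos_pos mult_pos_pos omega_pos zero_less_power Gamma_real_pos) auto

lemma m_const_times_k_const:
  assumes "N > 0" "s > 0"
  shows "m_const N s * (k_const N s / s) = 1 / omega N"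
proof -
  have "k_const N 1 = 1 / (2 * omega N)" by (simp add: k_const_def powr_minus field_simps)
  then show ?thesis
    using k_const_pos[OF assms] assms by (simp add: m_const_def)
qed

text \<open>This matches the factor \<open>4 * (s - 1)\<close> that the Laplacian produces with the passage from
  \<open>m_const N s\<close> to \<open>m_const N (s - 1)\<close>.\<close>

lemma k_const_step:
  assumes "s > 1"
  shows "4 * (s - 1) * k_const N s = k_const N (s - 1) / (s - 1)"
proof -
  have G: "Gamma s = (s - 1) * Gamma (s - 1)"
    using Gamma_plus1[of "s - 1"] nonpos_Ints_nonpos[of "s - 1"] assms by fastforce
  have "2 powr (1 - 2 * (s - 1)) = (4::real) * 2 powr (1 - 2 * s)"
    using powr_add[of "2::real" 2 "1 - 2 * s"] by simp
  then show ?thesis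
    using assms by (simp add: k_const_def G power_mult_distrib) (simp add: divide_simps power2_eq_square)
qed

theorem lemma1p8:
  fixes m :: nat and \<sigma> s :: real and x z :: "real ^ 'n"
  assumes "0 < \<sigma>" and "\<sigma> \<le> 1" and "s = real m + \<sigma>"
    and "x \<in> ball 0 1" and "z \<in> sphere 0 1"
  shows
    "((\<exists>L. has_bdry_trace s (green s x) z L) \<and>
      edenhofer m s x z = m_const CARD('n) s * bdry_trace s (green s x) z \<and>
      m_const CARD('n) s * bdry_trace s (green s x) z
        = 1 / omega CARD('n) * (delta x powr s / norm (x - z) ^ CARD('n)) \<and>
      1 / omega CARD('n) * (delta x powr s / norm (x - z) ^ CARD('n))
        = m_const CARD('n) s * martin s x z) \<and>
     (m \<ge> 1 \<longrightarrow>
      (\<exists>L. has_bdry_trace (s - 1) (\<lambda>y. - laplacian (green s x) y) z L) \<and>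
      edenhofer (m - 1) s x z
        = m_const CARD('n) (s - 1) * bdry_trace (s - 1) (\<lambda>y. - laplacian (green s x) y) z \<and>
      m_const CARD('n) (s - 1) * bdry_trace (s - 1) (\<lambda>y. - laplacian (green s x) y) z
        = 1 / (4 * omega CARD('n)) * (delta x powr s / norm (x - z) ^ (CARD('n) + 2)) *
          (real CARD('n) * delta x - (real CARD('n) - 4) * (norm (x - z))\<^sup>2) \<and>
      (\<exists>L. has_bdry_trace (s - 2) (laplacian (green s x)) z L) \<and>
      edenhofer m s x z
        = m_const CARD('n) (s - 1) * bdry_trace (s - 2) (laplacian (green s x)) z)"
proof -
  define N where "N = CARD('n)"
  define e r where "e = delta x" and "r = norm (x - z)"
  have N: "N > 0" by (simp add: N_def)
  have s: "s > 0" using assms by linarith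
  have z: "norm z = 1" using assms by simp
  have xz: "x \<noteq> z" using assms by auto
  have x: "x \<bullet> x < 1" using assms by (simp add: norm_lt_square)
  have e: "1 - x \<bullet> x = e" using x by (simp add: e_def delta_def power2_norm_eq_inner)
  have ceil: "\<lceil>s\<rceil> = int m + 1" using assms by (intro ceiling_unique) auto
  note tr = has_bdry_trace_green[OF s x z xz, unfolded e, folded N_def r_def]
  note zeta0 = bdry_trace_eqI[OF z has_bdry_trace_zeta(1)[OF z xz, folded N_def r_def]]
  note zeta1 = bdry_trace_eqI[OF z has_bdry_trace_zeta(2)[OF z xz, unfolded e, folded N_def r_def]]
  have E: "edenhofer m s x z = 1 / omega N * (e powr s / r ^ N)"
    by (simp add: edenhofer_def ceil zeta0 N_def e_def)
  have M: "1 / omega N * (e powr s / r ^ N) = m_const N s * martin s x z"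
  proof -
    have "m_const N s * martin s x z = m_const N s * (k_const N s / s) * (e powr s / r ^ N)"
      by (simp add: martin_def N_def e_def r_def)
    then show ?thesis by (simp only: m_const_times_k_const[OF N s])
  qed
  have T: "m_const N s * bdry_trace s (green s x) z = 1 / omega N * (e powr s / r ^ N)"
    unfolding bdry_trace_eqI[OF z tr] m_const_times_k_const[OF N s, symmetric] by simp
  have part2: "(\<exists>L. has_bdry_trace (s - 1) (\<lambda>y. - laplacian (green s x) y) z L) \<and>
      edenhofer (m - 1) s x z = m_const N (s - 1) * bdry_trace (s - 1) (\<lambda>y. - laplacian (green s x) y) z \<and>
      m_const N (s - 1) * bdry_trace (s - 1) (\<lambda>y. - laplacian (green s x) y) z
        = 1 / (4 * omega N) * (e powr s / r ^ (N + 2)) * (real N * e - (real N - 4) * r\<^sup>2) \<and>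
      (\<exists>L. has_bdry_trace (s - 2) (laplacian (green s x)) z L) \<and>
      edenhofer m s x z = m_const N (s - 1) * bdry_trace (s - 2) (laplacian (green s x)) z"
    if m: "m \<ge> 1"
  proof -
    have s1: "s > 1" "s - 1 > 0" using m assms by linarith+
    note trl = has_bdry_trace_laplacian_green[OF s1(1) x z xz, unfolded e, folded N_def r_def]
    have mk: "m_const N (s - 1) * (4 * (s - 1) * k_const N s) = 1 / omega N"
      unfolding k_const_step[OF s1(1)] by (rule m_const_times_k_const[OF N s1(2)])
    have "real m - real (m - 1) = 1" using m by simp
    then have E1: "edenhofer (m - 1) s x z
        = 1 / (4 * omega N) * (e powr s / r ^ (N + 2)) * (real N * e - (real N - 4) * r\<^sup>2)"
      by (simp add: edenhofer_def ceil zeta1 N_def[symmetric] e_def[symmetric] del: of_nat_diff)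
    have T1: "m_const N (s - 1) * bdry_trace (s - 1) (\<lambda>y. - laplacian (green s x) y) z
        = 1 / (4 * omega N) * (e powr s / r ^ (N + 2)) * (real N * e - (real N - 4) * r\<^sup>2)"
    proof -
      have "m_const N (s - 1) * bdry_trace (s - 1) (\<lambda>y. - laplacian (green s x) y) z
          = (m_const N (s - 1) * (4 * (s - 1) * k_const N s)) / 4 * (e powr s / r ^ (N + 2))
              * (real N * e - (real N - 4) * r\<^sup>2)"
        unfolding bdry_trace_eqI[OF z trl(2)] by (simp add: right_diff_distrib' left_diff_distrib' diff_divide_distrib)
      then show ?thesis unfolding mk by simp
    qed
    have T2: "m_const N (s - 1) * bdry_trace (s - 2) (laplacian (green s x)) z
        = 1 / omega N * (e powr s / r ^ N)"
      unfolding bdry_trace_eqI[OF z trl(1)] mk[symmetric] by simp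
    show ?thesis using E1 T1 T2 E trl by metis
  qed
  show ?thesis
    using tr E M T part2 unfolding N_def e_def r_def by metis
qed

end
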